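(* Let $X$ be a Tychonov space. Then $w(X)\le \mathrm{Sln}(X)^+$. Moreover, if no $\kappa^+$-Suslin tree exists for $\kappa=\mathrm{Sln}(X)$, then $w(X)\le\mathrm{Sln}(X)$.
   Context: A continuum is a compact connected Hausdorff space; it is non-degenerate if it has more than one point. For a continuum $K$, the Suslinian number is $\mathrm{Sln}(K)=\sup\{|\mathcal C| : \mathcal C \text{ is a disjoint family of non-degenerate subcontinua of } K\}$. For a Tychonov space $X$, $\mathrm{Sln}(X)=\min\{\mathrm{Sln}(K): K \text{ is a continuum containing } X \text{ (as a subspace, up to homeomorphism)}\}$. Convention: the value of $\mathrm{Sln}$ is taken to be an infinite cardinal (i.e. replaced by $\max\{\aleph_0,\mathrm{Sln}\}$; this only affects spaces with at most one point). $w(X)$ is the weight of $X$, the smallest cardinality of a base of the topology. $\kappa^+$ denotes the successor cardinal of $\kappa$. A tree is called $\lambda$-Suslin (for a cardinal $\lambda$) if it has height $\lambda$ but contains no chain and no antichain of cardinality $\lambda$. *)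

theory Defs
  imports "HOL-Analysis.Analysis"
begin

unbundle cardinal_syntax

text \<open>
  As in the library, cardinals are represented by \<open>Card_order\<close> relations and compared by
  \<open>\<le>o\<close>, hence they are determined up to \<open>=o\<close> only.
  The least upper bound below is taken among the cardinals represented on the type \<open>'c\<close>; as
  \<open>|UNIV :: 'c set|\<close> is an upper bound, this is the least upper bound among all cardinals.
\<close>

definition card_Sup :: "'c set set \<Rightarrow> 'c rel" where
  "card_Sup \<A> =
    (SOME r. Card_order r \<and> (\<forall>A\<in>\<A>. |A| \<le>o r) \<and>
             (\<forall>r' :: 'c rel. Card_order r' \<and> (\<forall>A\<in>\<A>. |A| \<le>o r') \<longrightarrow> r \<le>o r'))"

definition card_Min :: "'c rel set \<Rightarrow> 'c rel" where
  "card_Min R = (SOME r. r \<in> R \<and> (\<forall>r'\<in>R. r \<le>o r'))"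

lemma card_Sup:
  fixes \<A> :: "'c set set"
  shows "Card_order (card_Sup \<A>)"
    and "A \<in> \<A> \<Longrightarrow> |A| \<le>o card_Sup \<A>"
    and "\<lbrakk>Card_order r; \<And>A. A \<in> \<A> \<Longrightarrow> |A| \<le>o r\<rbrakk> \<Longrightarrow> card_Sup \<A> \<le>o (r :: 'b rel)"
proof -
  let ?ub = "\<lambda>r :: 'c rel. Card_order r \<and> (\<forall>A\<in>\<A>. |A| \<le>o r)"
  have univ: "?ub |UNIV :: 'c set|"
    by (simp add: card_of_Card_order card_of_mono1)
  have "\<exists>r\<in>Collect ?ub. \<forall>r'\<in>Collect ?ub. r \<le>o r'"
    by (rule exists_minim_Card_order) (use univ in auto)
  then have "\<exists>r :: 'c rel. Card_order r \<and> (\<forall>A\<in>\<A>. |A| \<le>o r) \<and>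
      (\<forall>r' :: 'c rel. Card_order r' \<and> (\<forall>A\<in>\<A>. |A| \<le>o r') \<longrightarrow> r \<le>o r')"
    by blast
  from someI_ex[OF this, folded card_Sup_def]
  have 1: "Card_order (card_Sup \<A>)" and 2: "\<forall>A\<in>\<A>. |A| \<le>o card_Sup \<A>"
    and 3: "\<And>r' :: 'c rel. Card_order r' \<Longrightarrow> \<forall>A\<in>\<A>. |A| \<le>o r' \<Longrightarrow> card_Sup \<A> \<le>o r'"
    by blast+
  show "Card_order (card_Sup \<A>)" by (fact 1)
  show "|A| \<le>o card_Sup \<A>" if "A \<in> \<A>" using 2 that by blast
  show "card_Sup \<A> \<le>o r" if r: "Card_order r" "\<And>A. A \<in> \<A> \<Longrightarrow> |A| \<le>o r" for r :: "'b rel"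
  proof (rule ccontr)
    have wo: "Well_order r" "Well_order (card_Sup \<A>)"
      using r(1) 1 by (auto simp: card_order_on_def)
    assume "\<not> card_Sup \<A> \<le>o r"
    then have less: "r <o card_Sup \<A>"
      using wo not_ordLeq_iff_ordLess by blast
    then obtain r' :: "'c rel" where r': "r =o r'" "r' <o card_Sup \<A>"
      using internalize_ordLess[of r "card_Sup \<A>"] by blast
    have "Card_order r'"
      using r(1) r'(1) Card_order_ordIso2 by blast
    moreover have "\<forall>A\<in>\<A>. |A| \<le>o r'"
      using r(2) r'(1) ordLeq_ordIso_trans by blast
    ultimately have "card_Sup \<A> \<le>o r'" by (rule 3)
    with r'(2) show False using not_ordLess_ordLeq by blast
  qed
qed

lemma card_Min:
  assumes "R \<noteq> {}" and "\<And>r. r \<in> R \<Longrightarrow> Card_order r"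
  shows "card_Min R \<in> R" and "r \<in> R \<Longrightarrow> card_Min R \<le>o r"
proof -
  have "\<exists>r. r \<in> R \<and> (\<forall>r'\<in>R. r \<le>o r')"
    using exists_minim_Card_order[of R] assms by blast
  from someI_ex[OF this, folded card_Min_def]
  show "card_Min R \<in> R" and "r \<in> R \<Longrightarrow> card_Min R \<le>o r" by blast+
qed

definition tychonov_space :: "'a topology \<Rightarrow> bool" where
  "tychonov_space X \<longleftrightarrow> completely_regular_space X \<and> Hausdorff_space X"

definition base_of :: "'a topology \<Rightarrow> 'a set set \<Rightarrow> bool" where
  "base_of X \<B> \<longleftrightarrow> openin X = arbitrary union_of (\<lambda>U. U \<in> \<B>)"

definition weight :: "'a topology \<Rightarrow> 'a set rel" where
  "weight X = card_Min (card_of ` {\<B>. base_of X \<B>})"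

definition continuum :: "'a topology \<Rightarrow> bool" where
  "continuum K \<longleftrightarrow> compact_space K \<and> connected_space K \<and> Hausdorff_space K"

definition nondegenerate_subcontinuum :: "'a topology \<Rightarrow> 'a set \<Rightarrow> bool" where
  "nondegenerate_subcontinuum K C \<longleftrightarrow>
     C \<subseteq> topspace K \<and> continuum (subtopology K C) \<and> (\<exists>x\<in>C. \<exists>y\<in>C. x \<noteq> y)"

text \<open>
  The summand \<open>natLeq\<close> implements the convention that Suslinian numbers are infinite:
  \<open>natLeq +c r\<close> is the maximum of \<open>\<aleph>\<^sub>0\<close> and \<open>r\<close>.
\<close>

definition Sln_continuum :: "'a topology \<Rightarrow> (nat + 'a set) rel" where
  "Sln_continuum K =
     natLeq +c card_Sup {\<C>. disjoint \<C> \<and> (\<forall>C\<in>\<C>. nondegenerate_subcontinuum K C)}"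

text \<open>
  A minimum over the continua of all types cannot be expressed inside HOL, so the continua
  containing \<open>X\<close> are taken on the type \<open>('a, 'k) ambient\<close>. Its first summand carries a Tychonoff
  cube into which every Tychonov space on \<open>'a\<close> embeds (lemma \<open>ex_continuum_embedding\<close>), so the
  minimum is over a nonempty class. The parameter \<open>'k\<close> is arbitrary: every continuum, of whatever
  type, has a copy on \<open>('a, 'k) ambient\<close> for a suitable \<open>'k\<close>. Statements about \<open>Sln TYPE('k) X\<close>
  should therefore be made for all \<open>'k\<close>.
\<close>

type_synonym ('a, 'k) ambient = "(('a \<Rightarrow> real) \<Rightarrow> real) + 'k"

definition Sln :: "'k itself \<Rightarrow> 'a topology \<Rightarrow> (nat + ('a, 'k) ambient set) rel" where
  "Sln U X =
     card_Min {Sln_continuum K | K :: ('a, 'k) ambient topology.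
                 continuum K \<and> (\<exists>e. embedding_map X K e)}"

lemma Card_order_Sln_continuum: "Card_order (Sln_continuum K)"
  by (simp add: Sln_continuum_def Card_order_csum)

lemma base_of_openin: "base_of X {U. openin X U}"
  unfolding base_of_def
  by (simp add: openin_topology_base_unique) blast

lemma homeomorphic_map_Inl_copy:
  fixes K :: "'a topology"
  defines "K' \<equiv> pullback_topology (range Inl) projl K :: ('a + 'b) topology"
  shows "homeomorphic_map K K' Inl"
proof (rule homeomorphic_maps_imp_map)
  show "homeomorphic_maps K K' Inl projl"
    unfolding homeomorphic_maps_def
  proof (intro conjI ballI)
    show "continuous_map K K' Inl"
      unfolding K'_def by (rule continuous_map_pullback') (auto simp: o_def)
    have "continuous_map K' K (id \<circ> projl)"
      unfolding K'_def by (rule continuous_map_pullback) simp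
    then show "continuous_map K' K projl" by simp
  qed (auto simp: K'_def topspace_pullback_topology)
qed

lemma ex_continuum_embedding:
  fixes X :: "'a topology"
  assumes "tychonov_space X"
  shows "\<exists>(K :: ('a, 'k) ambient topology) e. continuum K \<and> embedding_map X K e"
proof -
  obtain I :: "('a \<Rightarrow> real) set" and e
    where e: "embedding_map X (product_topology (\<lambda>f. top_of_set {0..1::real}) I) e"
    using assms completely_regular_space_cube_embedding unfolding tychonov_space_def by metis
  define Q where "Q = product_topology (\<lambda>f :: 'a \<Rightarrow> real. top_of_set {0..1::real}) I"
  define Q' where "Q' = (pullback_topology (range Inl) projl Q :: ('a, 'k) ambient topology)"
  have hom: "homeomorphic_map Q Q' Inl"
    unfolding Q'_def by (rule homeomorphic_map_Inl_copy)
  have "compact_space Q" "Hausdorff_space Q" "connected_space Q"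
    unfolding Q_def
    by (auto simp: compact_space_product_topology Hausdorff_space_product_topology
        connected_space_product_topology compact_space_subtopology Hausdorff_space_subtopology
        connected_space_subtopology)
  moreover have "Q homeomorphic_space Q'"
    using hom homeomorphic_map_imp_homeomorphic_space by blast
  ultimately have "continuum Q'"
    unfolding continuum_def
    using homeomorphic_compact_space homeomorphic_connected_space homeomorphic_Hausdorff_space
    by blast
  moreover have "embedding_map X Q' (Inl \<circ> e)"
    using e hom embedding_map_compose unfolding Q_def
    by (metis embedding_map_def homeomorphic_imp_surjective_map subtopology_topspace)
  ultimately show ?thesis by blast
qed

text \<open>
  A tree is given by its reflexive order \<open>T\<close>, with \<open>Field T\<close> as set of nodes. For a node \<open>x\<close>,
  \<open>node_height T x\<close> is the well-order of its strict predecessors; its order type is the height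
  of \<open>x\<close>.
\<close>

definition node_height :: "'t rel \<Rightarrow> 't \<Rightarrow> 't rel" where
  "node_height T x = Restr T (underS T x)"

definition is_tree :: "'t rel \<Rightarrow> bool" where
  "is_tree T \<longleftrightarrow>
     Partial_order T \<and> (\<forall>x\<in>Field T. well_order_on (underS T x) (node_height T x))"

text \<open>
  The height of a tree is the least ordinal exceeding the heights of all nodes. Every ordinal
  below \<open>l\<close> is represented on the type of \<open>l\<close>, so it suffices to compare with ordinals \<open>l'\<close> there.
\<close>

definition has_height :: "'t rel \<Rightarrow> 'l rel \<Rightarrow> bool" where
  "has_height T l \<longleftrightarrow>
     (\<forall>x\<in>Field T. node_height T x <o l) \<and>
     (\<forall>l' :: 'l rel. Well_order l' \<and> (\<forall>x\<in>Field T. node_height T x <o l') \<longrightarrow> l \<le>o l')"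

definition antichain :: "'t rel \<Rightarrow> 't set \<Rightarrow> bool" where
  "antichain T A \<longleftrightarrow>
     A \<subseteq> Field T \<and> (\<forall>x\<in>A. \<forall>y\<in>A. x \<noteq> y \<longrightarrow> (x, y) \<notin> T \<and> (y, x) \<notin> T)"

definition Suslin_tree :: "'l rel \<Rightarrow> 't rel \<Rightarrow> bool" where
  "Suslin_tree l T \<longleftrightarrow>
     is_tree T \<and> has_height T l \<and>
     \<not> (\<exists>C\<in>Chains T. |C| =o l) \<and> \<not> (\<exists>A. antichain T A \<and> |A| =o l)"

text \<open>
  For an infinite successor cardinal \<open>l\<close>, the levels of an \<open>l\<close>-Suslin tree are antichains and
  there are \<open>l\<close> of them, so the tree has exactly \<open>l\<close> nodes and is isomorphic to one on the type
  of \<open>l\<close>. Hence the following excludes \<open>l\<close>-Suslin trees on any type.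
\<close>

definition no_Suslin_tree :: "'l rel \<Rightarrow> bool" where
  "no_Suslin_tree l \<longleftrightarrow> \<not> (\<exists>T :: 'l rel. Suslin_tree l T)"

end

theory Submission
  imports Defs
begin

text \<open>
  Let \<open>K\<close> be a continuum containing \<open>X\<close> with \<open>Sln(K) = Sln(X) = \<kappa>\<close>. Since \<open>w(X) \<le> w(K)\<close>, it suffices
  to bound \<open>w(K)\<close>, and \<open>K\<close> may be assumed to have more than one point.

  The continuum is cut into pieces over and over again. For every non-degenerate subcontinuum \<open>F\<close>
  fix a continuous real function \<open>g\<^sub>F\<close> on \<open>K\<close> that is not constant on \<open>F\<close>; the pieces of \<open>F\<close> are the
  non-degenerate components of the level sets of \<open>g\<^sub>F\<close> in \<open>F\<close>. Start with \<open>K\<close>, pass from a set to its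
  pieces, and at limits take intersections as long as they remain non-degenerate. The subcontinua
  that arise are the nodes of a tree under reverse inclusion (\<open>is_tree_node_order\<close>): any two nodes
  that meet are comparable, and predecessors are well-ordered.

  \<^item> Antichains consist of disjoint non-degenerate subcontinua, so they have at most \<open>\<kappa>\<close> elements.
  \<^item> If a node \<open>F\<close> of a chain has nodes of the chain strictly inside it, all of these lie in a single
    piece of \<open>F\<close>, and by boundary bumping there is a non-degenerate subcontinuum of \<open>F\<close> that avoids
    this piece. The subcontinua obtained from different \<open>F\<close> are disjoint, so chains also have at most
    \<open>\<kappa>\<close> elements (\<open>card_chain_le\<close>).
  \<^item> Hence all heights are below \<open>\<kappa>\<^sup>+\<close> and all levels have at most \<open>\<kappa>\<close> nodes, which leaves at most
    \<open>\<kappa>\<^sup>+\<close> nodes. If there are more than \<open>\<kappa>\<close> of them, then the height is exactly \<open>\<kappa>\<^sup>+\<close> and the tree is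
    \<open>\<kappa>\<^sup>+\<close>-Suslin (\<open>large_tree_Suslin\<close>).

  It remains to see that \<open>w(K)\<close> is at most \<open>\<kappa>\<close> or the number of nodes, whichever is larger. A
  non-degenerate subcontinuum \<open>C\<close> lies in a smallest node \<open>M\<close>. If \<open>g\<^sub>M\<close> were constant on \<open>C\<close>, then \<open>C\<close>
  would lie in a piece of \<open>M\<close>, a smaller node. So the functions \<open>g\<^sub>F\<close>, for \<open>F\<close> a node, are jointly
  light: no non-degenerate subcontinuum lies in a fibre of all of them. For a light family
  \<open>\<F>\<close>, intersect finitely many sets of the form \<open>{x. p \<le> f x \<le> q}\<close> with \<open>f \<in> \<F>\<close> and \<open>p\<close>, \<open>q\<close> rational, and
  collect the non-degenerate components of all these intersections. They form a network of \<open>K\<close>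
  (\<open>network_of_slab_network\<close>), and each intersection contributes at most \<open>\<kappa>\<close> of them. Finally, in a
  compact Hausdorff space a network of size at most \<open>\<mu>\<close> yields a base of size at most \<open>\<mu>\<close>, for infinite \<open>\<mu>\<close>
  (\<open>Cinfinite_base_of_if_network_of\<close>).
\<close>

section \<open>Cardinalities\<close>

lemma countable_ordLeq_Cinfinite:
  assumes "countable A" "Cinfinite r"
  shows "|A| \<le>o r"
proof -
  obtain f :: "'a \<Rightarrow> nat" where "inj_on f A"
    using assms(1) by (auto simp: countable_def)
  then have "|A| \<le>o |UNIV :: nat set|"
    by (intro card_of_ordLeqI) auto
  also have "|UNIV :: nat set| =o natLeq" by (rule card_of_nat)
  also have "natLeq \<le>o r" using assms(2) by (rule natLeq_ordLeq_cinfinite)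
  finally show ?thesis .
qed

lemma card_finite_subsets_ordLeq:
  assumes A: "|A| \<le>o r" and r: "Cinfinite r"
  shows "|{F. F \<subseteq> A \<and> finite F}| \<le>o r"
proof -
  have "|{F. F \<subseteq> A \<and> finite F \<and> card F = n}| \<le>o r" for n
  proof (induction n)
    case 0
    have "{F. F \<subseteq> A \<and> finite F \<and> card F = 0} = {{}}" by auto
    then have "countable {F. F \<subseteq> A \<and> finite F \<and> card F = 0}" by (metis countable_empty countable_insert)
    then show ?case using r by (rule countable_ordLeq_Cinfinite)
  next
    case (Suc n)
    let ?S = "{F. F \<subseteq> A \<and> finite F \<and> card F = n}"
    have "{F. F \<subseteq> A \<and> finite F \<and> card F = Suc n} \<subseteq> (\<lambda>(a, F). insert a F) ` (A \<times> ?S)"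
    proof
      fix F assume F: "F \<in> {F. F \<subseteq> A \<and> finite F \<and> card F = Suc n}"
      then obtain a G where G: "F = insert a G" "card G = n"
        unfolding card_Suc_eq by blast
      then have "(a, G) \<in> A \<times> ?S" using F by simp
      then show "F \<in> (\<lambda>(a, F). insert a F) ` (A \<times> ?S)"
        by (rule image_eqI[rotated]) (simp add: G)
    qed
    then have "|{F. F \<subseteq> A \<and> finite F \<and> card F = Suc n}| \<le>o |A \<times> ?S|"
      by (rule ordLeq_transitive[OF card_of_mono1 card_of_image])
    also have "|A \<times> ?S| \<le>o r"
      using r A Suc by (intro card_of_Times_ordLeq_infinite_Field) (auto simp: cinfinite_def)
    finally show ?case .
  qed
  moreover have "|UNIV :: nat set| \<le>o r"
    using r by (intro countable_ordLeq_Cinfinite) auto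
  ultimately have "|\<Union>n. {F. F \<subseteq> A \<and> finite F \<and> card F = n}| \<le>o r"
    using r by (intro UNION_Cinfinite_bound ballI)
  moreover have "(\<Union>n. {F. F \<subseteq> A \<and> finite F \<and> card F = n}) = {F. F \<subseteq> A \<and> finite F}" by auto
  ultimately show ?thesis by simp
qed

section \<open>Trees with small chains and antichains\<close>

lemma underS_Chains:
  assumes "is_tree T" "x \<in> Field T"
  shows "underS T x \<in> Chains T"
proof -
  have "Refl T" using assms by (simp add: is_tree_def order_on_defs)
  moreover have "total_on (underS T x) (node_height T x)"
    using assms by (simp add: is_tree_def order_on_defs)
  ultimately show ?thesis
    unfolding Chains_def total_on_def node_height_def refl_on_def underS_def
    by (auto dest: FieldI1)
qed

lemma Well_order_node_height:
  assumes "is_tree T" "x \<in> Field T"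
  shows "Well_order (node_height T x)" "Field (node_height T x) = underS T x"
  using assms well_order_on_Well_order[of "underS T x" "node_height T x"]
  by (auto simp: is_tree_def)

lemma node_height_strict_mono:
  assumes T: "is_tree T" and xy: "(x, y) \<in> T" "x \<noteq> y"
  shows "node_height T x <o node_height T y"
proof -
  have y: "y \<in> Field T" using xy by (auto simp: Field_def)
  have x: "x \<in> underS T y" using xy by (simp add: underS_def)
  have *: "trans T" "antisym T" using T by (auto simp: is_tree_def order_on_defs)
  then have sub: "underS T x \<subseteq> underS T y"
    using xy unfolding underS_def by (auto dest: transD antisymD)
  then have "underS (node_height T y) x = underS T x"
    using x by (auto simp: node_height_def underS_def)
  with sub have "Restr (node_height T y) (underS (node_height T y) x) = node_height T x"
    by (auto simp: node_height_def)
  with underS_Restr_ordLess[of "node_height T y" x] show ?thesis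
    using Well_order_node_height[OF T y] x by auto
qed

lemma level_antichain:
  fixes h :: "'h rel"
  assumes "is_tree T"
  shows "antichain T {x \<in> Field T. node_height T x =o h}"
  unfolding antichain_def
proof (intro conjI ballI impI)
  fix x y assume "x \<in> {x \<in> Field T. node_height T x =o h}" "y \<in> {x \<in> Field T. node_height T x =o h}"
    and "x \<noteq> y"
  then have "node_height T x =o node_height T y"
    using ordIso_symmetric ordIso_transitive by blast
  then show "(x, y) \<notin> T" "(y, x) \<notin> T"
    using node_height_strict_mono[OF assms] \<open>x \<noteq> y\<close> not_ordLess_ordIso ordIso_symmetric by blast+
qed auto

text \<open>
  A well-order \<open>l\<close> that is longer than all node heights indexes the levels, and levels are
  antichains. This is used twice: for the successor cardinal itself, which bounds the tree, and for
  a hypothetical shorter \<open>l\<close>, which shows that a large tree has full height.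
\<close>

lemma card_tree_le_height:
  assumes T: "is_tree T" and l: "Well_order l" "\<And>x. x \<in> Field T \<Longrightarrow> node_height T x <o l"
    and r: "Cinfinite r" "|Field l| \<le>o r" and anti: "\<And>A. antichain T A \<Longrightarrow> |A| \<le>o r"
  shows "|Field T| \<le>o r"
proof -
  let ?L = "\<lambda>a. {x \<in> Field T. node_height T x =o Restr l (underS l a)}"
  have "Field T \<subseteq> (\<Union>a\<in>Field l. ?L a)"
  proof
    fix x assume x: "x \<in> Field T"
    with ordLess_iff_ordIso_Restr[OF l(1) Well_order_node_height(1)[OF T x]] l(2)
    show "x \<in> (\<Union>a\<in>Field l. ?L a)" by blast
  qed
  then have "|Field T| \<le>o |\<Union>a\<in>Field l. ?L a|"
    by (rule card_of_mono1)
  also have "|\<Union>a\<in>Field l. ?L a| \<le>o r"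
    using level_antichain[OF T] by (intro UNION_Cinfinite_bound r ballI anti)
  finally show ?thesis .
qed

lemma ordLess_if_Field_ordLess:
  assumes "Well_order r" "Card_order l" "|Field r| <o l"
  shows "r <o l"
proof (rule ccontr)
  assume "\<not> r <o l"
  then have "l \<le>o r"
    using assms by (meson card_order_on_well_order_on not_ordLess_iff_ordLeq)
  then have "|Field l| \<le>o |Field r|" by (rule card_of_mono2)
  then have "l \<le>o |Field r|"
    by (rule ordIso_ordLeq_trans[OF ordIso_symmetric[OF card_of_Field_ordIso[OF assms(2)]]])
  with assms show False using not_ordLess_ordLeq by blast
qed

lemma node_height_less_cardSuc:
  assumes T: "is_tree T" "x \<in> Field T" and r: "Card_order r"
    and chain: "\<And>C. C \<in> Chains T \<Longrightarrow> |C| \<le>o r"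
  shows "node_height T x <o cardSuc r"
proof (rule ordLess_if_Field_ordLess)
  show "|Field (node_height T x)| <o cardSuc r"
    using chain[OF underS_Chains[OF T]] r
    by (simp add: Well_order_node_height(2)[OF T] cardSuc_ordLeq_ordLess card_of_Card_order)
qed (use Well_order_node_height(1)[OF T] r cardSuc_Card_order in auto)

lemma card_tree_le_cardSuc:
  assumes T: "is_tree T" and r: "Cinfinite r"
    and chain: "\<And>C. C \<in> Chains T \<Longrightarrow> |C| \<le>o r"
    and anti: "\<And>A. antichain T A \<Longrightarrow> |A| \<le>o r"
  shows "|Field T| \<le>o cardSuc r"
proof (rule card_tree_le_height[OF T])
  show "Well_order (cardSuc r)" using r cardSuc_Well_order by blast
  show "node_height T x <o cardSuc r" if "x \<in> Field T" for x
    using r by (intro node_height_less_cardSuc[OF T that _ chain]) auto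
  show "Cinfinite (cardSuc r)" using r by (rule Cinfinite_cardSuc)
  then show "|Field (cardSuc r)| \<le>o cardSuc r"
    by (intro ordIso_imp_ordLeq card_of_Field_ordIso) simp
  show "|A| \<le>o cardSuc r" if "antichain T A" for A
    by (rule ordLeq_transitive[OF anti[OF that] cardSuc_ordLeq]) (use r in simp)
qed

text \<open>
  A tree of height less than \<open>r\<^sup>+\<close> has at most \<open>r\<close> levels, hence at most \<open>r\<close> nodes. So a larger tree
  reaches the height \<open>r\<^sup>+\<close>, while its chains and antichains are too small to have size \<open>r\<^sup>+\<close>.
\<close>

lemma large_tree_Suslin:
  fixes T :: "'a rel" and r :: "'b rel"
  assumes T: "is_tree T" and r: "Cinfinite r"
    and chain: "\<And>C. C \<in> Chains T \<Longrightarrow> |C| \<le>o r"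
    and anti: "\<And>A. antichain T A \<Longrightarrow> |A| \<le>o r"
    and large: "\<not> |Field T| \<le>o r"
  shows "Suslin_tree (cardSuc r) T"
proof -
  have "cardSuc r \<le>o l" if l: "Well_order l" "\<And>x. x \<in> Field T \<Longrightarrow> node_height T x <o l"
    for l :: "'b set rel"
  proof (rule ccontr)
    assume "\<not> cardSuc r \<le>o l"
    moreover have "Well_order (cardSuc r)"
      using r by (simp add: cardSuc_Well_order)
    ultimately have "l <o cardSuc r"
      using not_ordLeq_iff_ordLess[OF l(1)] by blast
    with card_of_least[OF l(1)] have "|Field l| <o cardSuc r"
      by (rule ordLeq_ordLess_trans)
    then have "|Field l| \<le>o r"
      using r by (simp add: cardSuc_ordLeq_ordLess card_of_Card_order)
    with card_tree_le_height[OF T l r this anti] large show False by blast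
  qed
  then have "has_height T (cardSuc r)"
    unfolding has_height_def using node_height_less_cardSuc[OF T _ _ chain] r by auto
  moreover have "\<not> |A| =o cardSuc r" if "|A| \<le>o r" for A :: "'a set"
  proof
    assume "|A| =o cardSuc r"
    from ordIso_ordLeq_trans[OF ordIso_symmetric[OF this] that] show False
      using r cardSuc_greater not_ordLess_ordLeq by blast
  qed
  ultimately show ?thesis
    using T chain anti unfolding Suslin_tree_def by blast
qed

text \<open>
  The predicate \<open>no_Suslin_tree l\<close> speaks only of trees on the type of \<open>l\<close>. The following lemmas copy
  a tree along an injection, so that it also excludes small Suslin trees on other types.
\<close>

lemma dir_image_iff:
  assumes "inj_on f (Field T)" "x \<in> Field T" "y \<in> Field T"
  shows "(f x, f y) \<in> dir_image T f \<longleftrightarrow> (x, y) \<in> T"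
  using assms unfolding dir_image_def by (auto dest: FieldI1 FieldI2 inj_onD)

lemma underS_subset_Field: "underS T x \<subseteq> Field T"
  by (auto simp: underS_def Field_def)

lemma underS_dir_image:
  assumes "inj_on f (Field T)" "x \<in> Field T"
  shows "underS (dir_image T f) (f x) = f ` underS T x"
proof -
  have "underS (dir_image T f) (f x) = {f y | y. y \<in> Field T \<and> f y \<noteq> f x \<and> (f y, f x) \<in> dir_image T f}"
    using FieldI1[of _ "f x" "dir_image T f"] by (force simp: underS_def dir_image_Field)
  also have "\<dots> = {f y | y. y \<in> Field T \<and> y \<noteq> x \<and> (y, x) \<in> T}"
    using assms by (metis (no_types, lifting) dir_image_iff inj_on_eq_iff)
  also have "\<dots> = f ` underS T x"
    by (auto simp: underS_def dest: FieldI1)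
  finally show ?thesis .
qed

lemma Restr_dir_image:
  assumes "inj_on f (Field T)" "A \<subseteq> Field T"
  shows "Restr (dir_image T f) (f ` A) = dir_image (Restr T A) f"
proof
  show "Restr (dir_image T f) (f ` A) \<subseteq> dir_image (Restr T A) f"
  proof clarify
    fix x y assume "x \<in> A" "y \<in> A" "(f x, f y) \<in> dir_image T f"
    then have "(x, y) \<in> T" using dir_image_iff[OF assms(1)] assms(2) by blast
    with \<open>x \<in> A\<close> \<open>y \<in> A\<close> show "(f x, f y) \<in> dir_image (Restr T A) f"
      unfolding dir_image_def by blast
  qed
qed (auto simp: dir_image_def)

lemma node_height_dir_image:
  assumes "inj_on f (Field T)" "x \<in> Field T"
  shows "node_height (dir_image T f) (f x) = dir_image (node_height T x) f"
  unfolding node_height_def underS_dir_image[OF assms]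
  using Restr_dir_image[OF assms(1) underS_subset_Field] .

lemma Suslin_tree_dir_image:
  assumes T: "Suslin_tree l T" and f: "inj_on f (Field T)"
  shows "Suslin_tree l (dir_image T f)"
proof -
  let ?T = "dir_image T f"
  have tree: "is_tree T" using T by (simp add: Suslin_tree_def)
  have F: "Field ?T = f ` Field T" by (rule dir_image_Field)
  have f': "inj_on f (Field (node_height T x))" if "x \<in> Field T" for x
    using f Well_order_node_height[OF tree that] underS_subset_Field inj_on_subset by metis
  have iso: "node_height T x =o node_height ?T (f x)" if "x \<in> Field T" for x
    unfolding node_height_dir_image[OF f that]
    using Well_order_node_height[OF tree that] f'[OF that] by (intro dir_image_ordIso) auto
  have "well_order_on (underS ?T (f x)) (node_height ?T (f x))" if "x \<in> Field T" for x
  proof -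
    have "Well_order (node_height ?T (f x))"
      unfolding node_height_dir_image[OF f that]
      using Well_order_node_height[OF tree that] f'[OF that] Well_order_dir_image by blast
    moreover have "Field (node_height ?T (f x)) = underS ?T (f x)"
      unfolding node_height_dir_image[OF f that] underS_dir_image[OF f that] dir_image_Field
      using Well_order_node_height[OF tree that] by simp
    ultimately show ?thesis by simp
  qed
  moreover have "Partial_order ?T"
    using tree f Partial_order_dir_image by (auto simp: is_tree_def)
  ultimately have "is_tree ?T" unfolding is_tree_def F by blast
  moreover have "has_height ?T l"
  proof -
    have "node_height ?T (f x) <o l' \<longleftrightarrow> node_height T x <o l'" if "x \<in> Field T" for x l'
      using iso[OF that] ordIso_ordLess_trans ordIso_symmetric by metis
    then show ?thesis using T unfolding Suslin_tree_def has_height_def F by auto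
  qed
  moreover have preimage: "\<exists>B. A = f ` B \<and> B \<subseteq> Field T \<and> |B| =o |A|" if sub: "A \<subseteq> Field ?T" for A
  proof -
    obtain B where "A = f ` B" "B \<subseteq> Field T"
      using sub F by (metis subset_imageE)
    moreover have "|B| =o |f ` B|"
      using f \<open>B \<subseteq> Field T\<close> card_of_ordIsoI[of f B] by (auto simp: bij_betw_def intro: inj_on_subset)
    ultimately show ?thesis by blast
  qed
  moreover have "\<not> |A| =o l" if "A \<in> Chains ?T" for A
  proof
    assume "|A| =o l"
    have "A \<subseteq> Field ?T" using that by (auto simp: Chains_def Field_def)
    from preimage[OF this] obtain B where B: "A = f ` B" "B \<subseteq> Field T" "|B| =o |A|" by blast
    have "(x, y) \<in> T \<or> (y, x) \<in> T" if "x \<in> B" "y \<in> B" for x y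
    proof -
      have "(f x, f y) \<in> ?T \<or> (f y, f x) \<in> ?T"
        using \<open>A \<in> Chains ?T\<close> that B(1) unfolding Chains_def by blast
      then show ?thesis using dir_image_iff[OF f] that B(2) by blast
    qed
    then have "B \<in> Chains T" by (simp add: Chains_def)
    moreover have "|B| =o l" using B \<open>|A| =o l\<close> ordIso_transitive by blast
    ultimately show False using T by (auto simp: Suslin_tree_def)
  qed
  moreover have "\<not> |A| =o l" if "antichain ?T A" for A
  proof
    assume "|A| =o l"
    have "A \<subseteq> Field ?T" using that by (auto simp: antichain_def)
    from preimage[OF this] obtain B where B: "A = f ` B" "B \<subseteq> Field T" "|B| =o |A|" by blast
    have "(x, y) \<notin> T" if "x \<in> B" "y \<in> B" "x \<noteq> y" for x y
    proof -
      have "f x \<noteq> f y" using f that B(2) by (auto simp: inj_on_def)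
      then have "(f x, f y) \<notin> ?T"
        using \<open>antichain ?T A\<close> that B(1) unfolding antichain_def by blast
      then show ?thesis using dir_image_iff[OF f] that B(2) by blast
    qed
    then have "antichain T B" using B(2) by (auto simp: antichain_def)
    moreover have "|B| =o l" using B \<open>|A| =o l\<close> ordIso_transitive by blast
    ultimately show False using T by (auto simp: Suslin_tree_def)
  qed
  ultimately show ?thesis unfolding Suslin_tree_def by blast
qed

lemma card_tree_le_if_no_Suslin_tree:
  fixes T :: "'a rel" and r :: "'b rel"
  assumes T: "is_tree T" and r: "Cinfinite r"
    and chain: "\<And>C. C \<in> Chains T \<Longrightarrow> |C| \<le>o r"
    and anti: "\<And>A. antichain T A \<Longrightarrow> |A| \<le>o r"
    and none: "no_Suslin_tree (cardSuc r)"
  shows "|Field T| \<le>o r"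
proof (rule ccontr)
  assume "\<not> |Field T| \<le>o r"
  then have "Suslin_tree (cardSuc r) T"
    using large_tree_Suslin[OF T r chain anti] by blast
  moreover have "|Field T| \<le>o |Field (cardSuc r)|"
    by (rule ordLeq_ordIso_trans[OF card_tree_le_cardSuc[OF T r chain anti]
          ordIso_symmetric[OF card_of_Field_ordIso]])
      (use r cardSuc_Card_order in auto)
  then obtain f :: "'a \<Rightarrow> 'b set" where "inj_on f (Field T)"
    using card_of_ordLeq[of "Field T" "Field (cardSuc r)"] by blast
  ultimately have "Suslin_tree (cardSuc r) (dir_image T f)"
    by (rule Suslin_tree_dir_image)
  then show False using none unfolding no_Suslin_tree_def by blast
qed

section \<open>Trees of iterated splittings\<close>

definition nondegenerate :: "'a set \<Rightarrow> bool" where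
  "nondegenerate A \<longleftrightarrow> (\<exists>x\<in>A. \<exists>y\<in>A. x \<noteq> y)"

lemma nondegenerate_mono: "nondegenerate A \<Longrightarrow> A \<subseteq> B \<Longrightarrow> nondegenerate B"
  unfolding nondegenerate_def by blast

lemma nondegenerate_nonempty: "nondegenerate A \<Longrightarrow> A \<noteq> {}"
  unfolding nondegenerate_def by blast

text \<open>
  The combinatorial core of the splitting process: \<open>P\<close> stands for the non-degenerate subcontinua,
  and \<open>pieces F\<close> for the components into which \<open>F\<close> is split. The last assumption says that no single
  piece exhausts \<open>F\<close>: there is room for a member of \<open>P\<close> outside it. This makes pieces strictly smaller
  and is what limits the length of chains.
\<close>

locale splitting =
  fixes P :: "'a set \<Rightarrow> bool" and pieces :: "'a set \<Rightarrow> 'a set set" and top :: "'a set"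
  assumes P_top: "P top"
    and P_nondegenerate: "P F \<Longrightarrow> nondegenerate F"
    and P_Inter: "\<lbrakk>\<C> \<noteq> {}; \<And>F. F \<in> \<C> \<Longrightarrow> P F; chain_subset \<C>; nondegenerate (\<Inter>\<C>)\<rbrakk> \<Longrightarrow> P (\<Inter>\<C>)"
    and P_piece: "\<lbrakk>P F; C \<in> pieces F\<rbrakk> \<Longrightarrow> P C"
    and piece_subset: "\<lbrakk>P F; C \<in> pieces F\<rbrakk> \<Longrightarrow> C \<subseteq> F"
    and pieces_disjoint: "P F \<Longrightarrow> disjoint (pieces F)"
    and P_remainder: "\<lbrakk>P F; C \<in> pieces F\<rbrakk> \<Longrightarrow> \<exists>D. P D \<and> D \<subseteq> F - C"
begin

text \<open>
  Closing \<open>{top}\<close> under pieces and non-degenerate intersections of chains yields the same sets as a transfinite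
  iteration that takes intersections at limit stages, without any mention of ordinals. The price
  is that comparability of overlapping nodes has to be proved in the style of the Bourbaki-Witt
  fixed point theorem.
\<close>

inductive_set nodes :: "'a set set" where
  root: "top \<in> nodes"
| piece: "\<lbrakk>F \<in> nodes; C \<in> pieces F\<rbrakk> \<Longrightarrow> C \<in> nodes"
| limit: "\<lbrakk>\<C> \<noteq> {}; \<And>F. F \<in> \<C> \<Longrightarrow> F \<in> nodes; chain_subset \<C>; nondegenerate (\<Inter>\<C>)\<rbrakk> \<Longrightarrow> \<Inter>\<C> \<in> nodes"

lemma node_P: "F \<in> nodes \<Longrightarrow> P F"
  by (induction rule: nodes.induct) (auto intro: P_top P_piece P_Inter)

lemma node_subset_top: "F \<in> nodes \<Longrightarrow> F \<subseteq> top"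
proof (induction rule: nodes.induct)
  case (piece F C)
  then show ?case using piece_subset[OF node_P] by blast
qed auto

lemma node_nonempty: "F \<in> nodes \<Longrightarrow> F \<noteq> {}"
  using node_P P_nondegenerate nondegenerate_nonempty by blast

lemma piece_psubset:
  assumes "F \<in> nodes" "C \<in> pieces F"
  shows "C \<subset> F"
proof -
  obtain D where "P D" "D \<subseteq> F - C" using P_remainder[OF node_P] assms by blast
  then show ?thesis
    using P_nondegenerate nondegenerate_nonempty piece_subset[OF node_P] assms by blast
qed

lemma pieces_eq:
  assumes "F \<in> nodes" "C \<in> pieces F" "C' \<in> pieces F" "C \<inter> C' \<noteq> {}"
  shows "C = C'"
  using pieces_disjoint[OF node_P[OF assms(1)]] assms by (auto simp: disjoint_def)

text \<open>
  Call a node \<open>N\<close> extreme if no node strictly above \<open>N\<close> cuts it, i.e. \<open>N\<close> lies in one piece of each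
  such node. Relative to an extreme node, the generation of the other nodes cannot skip anything:
  going down from \<open>top\<close>, a node either leaves \<open>N\<close>, or still contains \<open>N\<close>, or arises from \<open>N\<close> itself
  and then lies in one of its pieces.
\<close>

lemma node_cases_if_extreme:
  assumes ext: "\<And>H. \<lbrakk>H \<in> nodes; N \<subset> H\<rbrakk> \<Longrightarrow> \<exists>C\<in>pieces H. N \<subseteq> C"
    and N: "N \<in> nodes" and H: "H \<in> nodes"
  shows "H \<inter> N = {} \<or> N \<subseteq> H \<or> (\<exists>C\<in>pieces N. H \<subseteq> C)"
  using H
proof (induction rule: nodes.induct)
  case root
  then show ?case using node_subset_top[OF N] by blast
next
  case (piece G H)
  have HG: "H \<subseteq> G" using piece piece_subset node_P by blast
  show ?case
  proof (cases "N \<subset> G")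
    case True
    then obtain C where C: "C \<in> pieces G" "N \<subseteq> C" using ext piece.hyps(1) by blast
    show ?thesis
      using pieces_eq[OF piece.hyps(1) C(1) piece.hyps(2)] C(2) by blast
  next
    case False
    then consider "G \<inter> N = {}" | "N = G" | "\<exists>C\<in>pieces N. G \<subseteq> C" using piece.IH by blast
    then show ?thesis
    proof cases
      case 1
      then show ?thesis using HG by blast
    next
      case 2
      then show ?thesis using piece.hyps(2) by blast
    next
      case 3
      then show ?thesis using HG by (meson subset_trans)
    qed
  qed
next
  case (limit \<C>)
  show ?case
  proof (cases "\<forall>F\<in>\<C>. N \<subseteq> F")
    case True
    then show ?thesis by (simp add: Inter_greatest)
  next
    case False
    then obtain F where F: "F \<in> \<C>" "F \<inter> N = {} \<or> (\<exists>C\<in>pieces N. F \<subseteq> C)"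
      using limit.IH by metis
    have "\<Inter>\<C> \<subseteq> F" using F(1) by (rule Inter_lower)
    with F(2) show ?thesis by (meson subset_trans disjoint_iff subsetD)
  qed
qed

text \<open>
  Every node is extreme, by induction on its generation. In both steps the preceding lemma is
  applied to an earlier node that contains \<open>N\<close>, its parent or a member of the chain.
\<close>

lemma node_extreme:
  assumes "N \<in> nodes" "H \<in> nodes" "N \<subset> H"
  shows "\<exists>C\<in>pieces H. N \<subseteq> C"
  using assms
proof (induction N arbitrary: H rule: nodes.induct)
  case root
  then show ?case using node_subset_top by blast
next
  case (piece G N)
  have N: "N \<in> nodes" "N \<noteq> {}" "N \<subset> G"
    using piece.hyps nodes.piece node_nonempty piece_psubset by blast+
  consider "H \<inter> G = {}" | "G \<subseteq> H" | C where "C \<in> pieces G" "H \<subseteq> C"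
    using node_cases_if_extreme[OF piece.IH piece.hyps(1) piece.prems(1)] by blast
  then show ?case
  proof cases
    case 1
    then show ?thesis using N piece.prems by blast
  next
    case 2
    show ?thesis
    proof (cases "G = H")
      case True
      then show ?thesis using piece.hyps(2) by blast
    next
      case False
      then have "\<exists>C\<in>pieces H. G \<subseteq> C" using 2 piece.IH[OF piece.prems(1)] by (simp add: psubset_eq)
      then show ?thesis using N(3) by (meson psubset_imp_subset subset_trans)
    qed
  next
    case 3
    then have "C \<inter> N \<noteq> {}" using N(2) piece.prems(2) by blast
    then have "C = N" by (rule pieces_eq[OF piece.hyps(1) 3(1) piece.hyps(2)])
    then show ?thesis using 3(2) piece.prems(2) by simp
  qed
next
  case (limit \<C>)
  \<comment> \<open>\<open>H\<close> is not below all of \<open>\<C>\<close>, as it strictly contains \<open>\<Inter>\<C>\<close>; so some member already lies strictly below \<open>H\<close>.\<close>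
  then obtain F where F: "F \<in> \<C>" "\<not> H \<subseteq> F" by blast
  have "H \<inter> F \<noteq> {}"
    using limit.prems(2) F(1) nondegenerate_nonempty[OF limit.hyps(4)] by blast
  moreover have "\<not> H \<subseteq> C" if "C \<in> pieces F" for C
    using that F(2) piece_subset[OF node_P[OF limit.hyps(2)[OF F(1)]] that] by blast
  moreover have "H \<inter> F = {} \<or> F \<subseteq> H \<or> (\<exists>C\<in>pieces F. H \<subseteq> C)"
    using limit.IH[OF F(1)] limit.hyps(2)[OF F(1)] limit.prems(1) by (rule node_cases_if_extreme)
  ultimately have "F \<subset> H"
    using F(2) by (simp add: psubset_eq)
  then have "\<exists>C\<in>pieces H. F \<subseteq> C" by (rule limit.IH[OF F(1) limit.prems(1)])
  then show ?case using Inter_lower[OF F(1)] by (meson subset_trans)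
qed

lemma overlapping_nodes_comparable:
  assumes "F \<in> nodes" "G \<in> nodes" "F \<inter> G \<noteq> {}"
  shows "F \<subseteq> G \<or> G \<subseteq> F"
proof -
  have "G \<inter> F = {} \<or> F \<subseteq> G \<or> (\<exists>C\<in>pieces F. G \<subseteq> C)"
    using node_extreme[OF assms(1)] assms(1,2) by (rule node_cases_if_extreme)
  then show ?thesis
    using piece_subset[OF node_P[OF assms(1)]] assms(3) by blast
qed

text \<open>
  The nodes containing \<open>S\<close> pairwise overlap, hence form a chain, and their intersection is again a
  node. Minimality shows that no piece of it contains \<open>S\<close>.
\<close>

lemma smallest_node_above:
  assumes "nondegenerate S" "S \<subseteq> top"
  obtains M where "M \<in> nodes" "S \<subseteq> M" "\<And>C. C \<in> pieces M \<Longrightarrow> \<not> S \<subseteq> C"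
proof
  define \<C> where "\<C> = {F \<in> nodes. S \<subseteq> F}"
  have S: "S \<subseteq> \<Inter>\<C>" by (auto simp: \<C>_def)
  have "chain_subset \<C>"
    using overlapping_nodes_comparable nondegenerate_nonempty[OF assms(1)]
    unfolding \<C>_def chain_subset_def by blast
  moreover have "\<C> \<noteq> {}" using assms(2) root by (auto simp: \<C>_def)
  ultimately show M: "\<Inter>\<C> \<in> nodes"
    using nondegenerate_mono[OF assms(1) S] by (intro limit) (auto simp: \<C>_def)
  show "S \<subseteq> \<Inter>\<C>" by (rule S)
  show "\<not> S \<subseteq> C" if "C \<in> pieces (\<Inter>\<C>)" for C
  proof
    assume "S \<subseteq> C"
    then have "C \<in> \<C>" using piece[OF M that] by (simp add: \<C>_def)
    then show False using piece_psubset[OF M that] by blast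
  qed
qed

text \<open>
  Each \<open>H \<in> \<S>\<close> lies in a piece of \<open>M\<close> because it is extreme. As the members of \<open>\<S>\<close> overlap and pieces
  are disjoint, it is the same piece for all of them.
\<close>

lemma common_piece:
  assumes "M \<in> nodes" "\<S> \<subseteq> nodes" "chain_subset \<S>" "\<And>H. H \<in> \<S> \<Longrightarrow> H \<subset> M" "\<S> \<noteq> {}"
  obtains C where "C \<in> pieces M" "\<Union>\<S> \<subseteq> C"
proof -
  obtain H0 where H0: "H0 \<in> \<S>" using assms by blast
  then obtain C where C: "C \<in> pieces M" "H0 \<subseteq> C" using node_extreme assms by blast
  have "H \<subseteq> C" if H: "H \<in> \<S>" for H
  proof -
    obtain C' where C': "C' \<in> pieces M" "H \<subseteq> C'" using node_extreme assms H by blast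
    have "H \<noteq> {}" "H0 \<noteq> {}" using node_nonempty assms H H0 by blast+
    moreover have "H \<subseteq> H0 \<or> H0 \<subseteq> H" using assms(3) H H0 unfolding chain_subset_def by blast
    ultimately have "C \<inter> C' \<noteq> {}" using C(2) C'(2) by blast
    then show ?thesis using pieces_eq[OF assms(1) C(1) C'(1)] C'(2) by simp
  qed
  then show ?thesis using that[OF C(1)] by blast
qed

text \<open>
  This is the well-foundedness of the tree. The smallest node above \<open>\<Union>\<S>\<close> belongs to \<open>\<S>\<close>: otherwise
  all members of \<open>\<S>\<close> would lie in one common piece of it.
\<close>

lemma chain_has_largest_node:
  assumes "\<S> \<subseteq> nodes" "chain_subset \<S>" "\<S> \<noteq> {}"
  shows "\<exists>M\<in>\<S>. \<forall>H\<in>\<S>. H \<subseteq> M"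
proof -
  obtain H0 where "H0 \<in> \<S>" using assms by blast
  then have "nondegenerate (\<Union>\<S>)"
    using assms(1) node_P P_nondegenerate nondegenerate_mono[of H0 "\<Union>\<S>"] by blast
  moreover have "\<Union>\<S> \<subseteq> top" using assms(1) node_subset_top by blast
  ultimately obtain M where M: "M \<in> nodes" "\<Union>\<S> \<subseteq> M" "\<And>C. C \<in> pieces M \<Longrightarrow> \<not> \<Union>\<S> \<subseteq> C"
    using smallest_node_above[of "\<Union>\<S>"] by metis
  have "M \<in> \<S>"
  proof (rule ccontr)
    assume "M \<notin> \<S>"
    then have "H \<subset> M" if "H \<in> \<S>" for H using that M(2) by blast
    then show False using common_piece[OF M(1) assms(1,2) _ assms(3)] M(3) by metis
  qed
  then show ?thesis using M(2) by blast
qed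

definition node_order :: "'a set rel" where
  "node_order = {(F, G). F \<in> nodes \<and> G \<in> nodes \<and> G \<subseteq> F}"

lemma Field_node_order: "Field node_order = nodes"
  by (auto simp: node_order_def Field_def)

lemma chain_subset_predecessors: "chain_subset (underS node_order F)"
  unfolding chain_subset_def
proof (intro ballI)
  fix G H assume "G \<in> underS node_order F" "H \<in> underS node_order F"
  then have GH: "G \<in> nodes" "H \<in> nodes" "F \<subseteq> G \<inter> H" "F \<in> nodes"
    by (auto simp: underS_def node_order_def)
  then have "G \<inter> H \<noteq> {}" using node_nonempty by blast
  with GH show "G \<subseteq> H \<or> H \<subseteq> G" by (intro overlapping_nodes_comparable)
qed

lemma is_tree_node_order: "is_tree node_order"
  unfolding is_tree_def
proof (intro conjI ballI)
  show "Partial_order node_order"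
    unfolding Field_node_order
    by (auto simp: node_order_def order_on_defs refl_on_def trans_def antisym_def)
  fix F assume "F \<in> Field node_order"
  let ?U = "underS node_order F" and ?h = "node_height node_order F"
  have U: "?U \<subseteq> nodes" by (auto simp: underS_def node_order_def)
  have "?h = {(G, H). G \<in> ?U \<and> H \<in> ?U \<and> H \<subseteq> G}"
    using U by (auto simp: node_height_def node_order_def)
  moreover have "wf (?h - Id)"
  proof (rule wfI_min)
    fix G :: "'a set" and Q assume "G \<in> Q"
    show "\<exists>z\<in>Q. \<forall>y. (y, z) \<in> ?h - Id \<longrightarrow> y \<notin> Q"
    proof (cases "Q \<inter> ?U = {}")
      case True
      then show ?thesis using \<open>G \<in> Q\<close> by (auto simp: node_height_def)
    next
      case False
      have "chain_subset (Q \<inter> ?U)"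
        using chain_subset_predecessors by (auto simp: chain_subset_def)
      then have "\<exists>M\<in>Q \<inter> ?U. \<forall>H\<in>Q \<inter> ?U. H \<subseteq> M"
        using U False by (intro chain_has_largest_node) auto
      then obtain M where M: "M \<in> Q \<inter> ?U" "\<And>H. H \<in> Q \<inter> ?U \<Longrightarrow> H \<subseteq> M"
        by meson
      have "y \<notin> Q" if "(y, M) \<in> ?h - Id" for y
        using that M(2)[of y] by (auto simp: node_height_def node_order_def)
      then show ?thesis using M(1) by (meson IntD1)
    qed
  qed
  ultimately show "well_order_on ?U ?h"
    using chain_subset_predecessors[of F]
    by (auto simp: order_on_defs refl_on_def trans_def antisym_def total_on_def chain_subset_def)
qed

lemma antichain_disjoint:
  assumes "antichain node_order \<A>"
  shows "disjoint \<A>"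
proof (rule disjointI)
  fix F G assume FG: "F \<in> \<A>" "G \<in> \<A>" "F \<noteq> G"
  then have "F \<in> nodes" "G \<in> nodes" using assms by (auto simp: antichain_def Field_node_order)
  then show "F \<inter> G = {}"
    using overlapping_nodes_comparable[of F G] assms FG
    by (auto simp: antichain_def node_order_def)
qed

text \<open>
  To every \<open>F\<close> in the chain that is not its last element, assign a set \<open>D F\<close> satisfying \<open>P\<close> inside \<open>F\<close>
  but outside the piece of \<open>F\<close> in which the chain continues. These sets are disjoint, because for
  \<open>G \<subset> F\<close> the set \<open>D G \<subseteq> G\<close> lies in the piece that \<open>D F\<close> avoids. So a chain is at most one element
  larger than a disjoint family.
\<close>

lemma card_chain_le:
  assumes r: "Cinfinite r"
    and disj: "\<And>\<D>. \<lbrakk>disjoint \<D>; \<And>D. D \<in> \<D> \<Longrightarrow> P D\<rbrakk> \<Longrightarrow> |\<D>| \<le>o r"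
    and \<C>: "\<C> \<subseteq> nodes" "chain_subset \<C>"
  shows "|\<C>| \<le>o r"
proof -
  define \<C>' where "\<C>' = {F \<in> \<C>. \<exists>G\<in>\<C>. G \<subset> F}"
  have "\<exists>D. P D \<and> D \<subseteq> F \<and> (\<forall>G\<in>\<C>. G \<subset> F \<longrightarrow> D \<inter> G = {})" if "F \<in> \<C>'" for F
  proof -
    let ?S = "{G \<in> \<C>. G \<subset> F}"
    have F: "F \<in> nodes" using that \<C> by (auto simp: \<C>'_def)
    have "?S \<subseteq> nodes" "chain_subset ?S" "?S \<noteq> {}"
      using that \<C> by (auto simp: \<C>'_def chain_subset_def)
    then obtain C where C: "C \<in> pieces F" "\<Union>?S \<subseteq> C"
      using common_piece[OF F, of ?S] by (metis (no_types, lifting) mem_Collect_eq)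
    obtain D where "P D" "D \<subseteq> F - C" using P_remainder[OF node_P[OF F] C(1)] by blast
    then show ?thesis using C(2) by (intro exI[of _ D]) blast
  qed
  then obtain D where D: "\<And>F. F \<in> \<C>' \<Longrightarrow> P (D F) \<and> D F \<subseteq> F"
    "\<And>F G. \<lbrakk>F \<in> \<C>'; G \<in> \<C>; G \<subset> F\<rbrakk> \<Longrightarrow> D F \<inter> G = {}"
    by metis
  have disjD: "D F \<inter> D G = {}" if "F \<in> \<C>'" "G \<in> \<C>'" "F \<noteq> G" for F G
  proof -
    have "F \<subset> G \<or> G \<subset> F" using that \<C>(2) by (auto simp: chain_subset_def \<C>'_def)
    then show ?thesis using D(1)[of F] D(1)[of G] D(2)[of F G] D(2)[of G F] that
      by (auto simp: \<C>'_def)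
  qed
  have "inj_on D \<C>'"
    using disjD D(1) P_nondegenerate nondegenerate_nonempty by (metis inf.idem inj_onI)
  then have "|\<C>'| =o |D ` \<C>'|"
    by (intro card_of_ordIsoI) (auto simp: bij_betw_def)
  also have "|D ` \<C>'| \<le>o r"
    using disjD D(1) by (intro disj disjointI) auto
  finally have "|\<C>'| \<le>o r" .
  moreover have "|\<C> - \<C>'| \<le>o r"
  proof (rule countable_ordLeq_Cinfinite[OF _ r])
    have "F = G" if "F \<in> \<C> - \<C>'" "G \<in> \<C> - \<C>'" for F G
    proof -
      have "F \<subseteq> G \<or> G \<subseteq> F" using that \<C>(2) by (simp add: chain_subset_def)
      moreover have "\<not> F \<subset> G" "\<not> G \<subset> F" using that by (simp_all add: \<C>'_def)
      ultimately show ?thesis by (simp add: psubset_eq) metis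
    qed
    then have "\<C> - \<C>' \<noteq> {} \<Longrightarrow> is_singleton (\<C> - \<C>')"
      by (intro is_singletonI')
    then have "finite (\<C> - \<C>')"
      by (metis finite.emptyI finite.insertI is_singleton_the_elem)
    then show "countable (\<C> - \<C>')" by (simp add: countable_finite)
  qed
  ultimately have "|\<C>' \<union> (\<C> - \<C>')| \<le>o r"
    using r by (rule Un_Cinfinite_bound)
  moreover have "\<C>' \<union> (\<C> - \<C>') = \<C>" by (auto simp: \<C>'_def)
  ultimately show ?thesis by simp
qed

lemma card_nodes_le:
  assumes r: "Cinfinite r"
    and disj: "\<And>\<D>. \<lbrakk>disjoint \<D>; \<And>D. D \<in> \<D> \<Longrightarrow> P D\<rbrakk> \<Longrightarrow> |\<D>| \<le>o r"
  shows "|nodes| \<le>o cardSuc r" and "no_Suslin_tree (cardSuc r) \<Longrightarrow> |nodes| \<le>o r"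
proof -
  have chain: "|\<C>| \<le>o r" if "\<C> \<in> Chains node_order" for \<C>
    using that by (intro card_chain_le[OF r disj]) (auto simp: Chains_def node_order_def chain_subset_def)
  have anti: "|\<A>| \<le>o r" if "antichain node_order \<A>" for \<A>
    using that node_P antichain_disjoint[OF that]
    by (intro disj) (auto simp: antichain_def Field_node_order)
  show "|nodes| \<le>o cardSuc r"
    using card_tree_le_cardSuc[OF is_tree_node_order r chain anti] by (simp add: Field_node_order)
  show "|nodes| \<le>o r" if "no_Suslin_tree (cardSuc r)"
    using card_tree_le_if_no_Suslin_tree[OF is_tree_node_order r chain anti that]
    by (simp add: Field_node_order)
qed

end

section \<open>Weight and networks\<close>

definition network_of :: "'a topology \<Rightarrow> 'a set set \<Rightarrow> bool" where
  "network_of X \<N> \<longleftrightarrow> (\<forall>U x. openin X U \<and> x \<in> U \<longrightarrow> (\<exists>N\<in>\<N>. x \<in> N \<and> N \<subseteq> U))"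

lemma base_of_iff:
  "base_of X \<B> \<longleftrightarrow> (\<forall>B\<in>\<B>. openin X B) \<and> (\<forall>U x. openin X U \<and> x \<in> U \<longrightarrow> (\<exists>B\<in>\<B>. x \<in> B \<and> B \<subseteq> U))"
  unfolding base_of_def using openin_topology_base_unique[of X "\<lambda>U. U \<in> \<B>"] by blast

lemma weight_ordLeq:
  assumes "base_of X \<B>" "|\<B>| \<le>o r"
  shows "weight X \<le>o r"
proof -
  have "weight X \<le>o |\<B>|"
    unfolding weight_def by (rule card_Min(2)) (use assms(1) card_of_Card_order in auto)
  then show ?thesis using assms(2) by (rule ordLeq_transitive)
qed

text \<open>
  For each pair of members of the network that have disjoint open neighbourhoods, choose such
  a neighbourhood of the first. The finite intersections of the chosen sets form a base: if \<open>x \<in> U\<close>, every point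
  outside \<open>U\<close> is separated from \<open>x\<close> by one of them, and finitely many suffice as the complement of \<open>U\<close>
  is compact.
\<close>

lemma Cinfinite_base_of_if_network_of:
  assumes X: "compact_space X" "Hausdorff_space X"
    and \<N>: "network_of X \<N>" "|\<N>| \<le>o r" and r: "Cinfinite r"
  obtains \<B> where "base_of X \<B>" "|\<B>| \<le>o r"
proof -
  define sep where "sep = (\<lambda>M N (U, V). openin X U \<and> openin X V \<and> M \<subseteq> U \<and> N \<subseteq> V \<and> disjnt U V)"
  define G where "G = (\<lambda>(M, N). if \<exists>p. sep M N p then fst (SOME p. sep M N p) else {})"
  define \<S> where "\<S> = G ` (\<N> \<times> \<N>)"
  define \<B> where "\<B> = (\<lambda>\<F>. topspace X \<inter> \<Inter>\<F>) ` {\<F>. \<F> \<subseteq> \<S> \<and> finite \<F>}"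
  have G: "openin X (G (M, N)) \<and> M \<subseteq> G (M, N) \<and> (\<exists>V. openin X V \<and> N \<subseteq> V \<and> disjnt (G (M, N)) V)"
    if "sep M N p" for M N p
  proof -
    have "sep M N (SOME p. sep M N p)" using that by (rule someI)
    moreover have "G (M, N) = fst (SOME p. sep M N p)" using that unfolding G_def by (metis (mono_tags, lifting) case_prod_conv)
    ultimately show ?thesis
      by (cases "SOME p. sep M N p") (auto simp: sep_def)
  qed
  have opS: "openin X S" if "S \<in> \<S>" for S
  proof -
    obtain M N where MN: "S = G (M, N)" using \<open>S \<in> \<S>\<close> by (auto simp: \<S>_def)
    show ?thesis
    proof (cases "\<exists>p. sep M N p")
      case True
      then show ?thesis using G[of M N] MN by metis
    next
      case False
      then have "S = {}" unfolding MN G_def by (metis (mono_tags, lifting) case_prod_conv)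
      then show ?thesis by simp
    qed
  qed
  have separate: "\<exists>S\<in>\<S>. \<exists>V. openin X V \<and> x \<in> S \<and> y \<in> V \<and> disjnt S V"
    if xy: "x \<in> topspace X" "y \<in> topspace X" "x \<noteq> y" for x y
  proof -
    obtain U V where UV: "openin X U" "openin X V" "x \<in> U" "y \<in> V" "disjnt U V"
      using X(2) xy unfolding Hausdorff_space_def by meson
    obtain M where M: "M \<in> \<N>" "x \<in> M" "M \<subseteq> U" using \<N>(1) UV unfolding network_of_def by meson
    obtain N where N: "N \<in> \<N>" "y \<in> N" "N \<subseteq> V" using \<N>(1) UV unfolding network_of_def by meson
    have "sep M N (U, V)" using UV M N by (simp add: sep_def)
    moreover have "G (M, N) \<in> \<S>" using M N by (auto simp: \<S>_def)
    ultimately show ?thesis using G[of M N] M(2) N(2) by (meson subsetD)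
  qed
  have "base_of X \<B>"
    unfolding base_of_iff
  proof (intro conjI allI impI ballI)
    show "openin X B" if "B \<in> \<B>" for B
    proof -
      obtain \<F> where \<F>: "B = topspace X \<inter> \<Inter>\<F>" "\<F> \<subseteq> \<S>" "finite \<F>"
        using \<open>B \<in> \<B>\<close> by (auto simp: \<B>_def)
      then have "B = \<Inter>(insert (topspace X) \<F>)" by auto
      moreover have "openin X (\<Inter>(insert (topspace X) \<F>))"
        using \<F> opS by (intro openin_Inter) auto
      ultimately show ?thesis by simp
    qed
    fix U x assume U: "openin X U \<and> x \<in> U"
    then have x: "x \<in> topspace X" using openin_subset by blast
    define \<V> where "\<V> = {V. openin X V \<and> (\<exists>S\<in>\<S>. x \<in> S \<and> disjnt S V)}"
    have "compactin X (topspace X - U)"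
      using U X(1) closedin_compact_space by blast
    moreover have "topspace X - U \<subseteq> \<Union>\<V>"
    proof
      fix y assume y: "y \<in> topspace X - U"
      then have "x \<noteq> y" using U by blast
      then show "y \<in> \<Union>\<V>" using separate[OF x, of y] y unfolding \<V>_def by blast
    qed
    ultimately obtain \<W> where \<W>: "finite \<W>" "\<W> \<subseteq> \<V>" "topspace X - U \<subseteq> \<Union>\<W>"
      unfolding compactin_def \<V>_def by (metis (no_types, lifting) mem_Collect_eq)
    have "\<forall>V\<in>\<W>. \<exists>S. S \<in> \<S> \<and> x \<in> S \<and> disjnt S V" using \<W>(2) by (auto simp: \<V>_def)
    then obtain S where S: "\<And>V. V \<in> \<W> \<Longrightarrow> S V \<in> \<S> \<and> x \<in> S V \<and> disjnt (S V) V" by metis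
    let ?B = "topspace X \<inter> \<Inter>(S ` \<W>)"
    have "?B \<in> \<B>"
      unfolding \<B>_def using S \<W>(1) by (intro imageI) auto
    moreover have "x \<in> ?B" using x S by auto
    moreover have "?B \<subseteq> U"
    proof
      fix y assume y: "y \<in> ?B"
      have "y \<notin> V" if "V \<in> \<W>" for V
        using S[OF that] y that by (auto simp: disjnt_iff)
      then show "y \<in> U" using y \<W>(3) by blast
    qed
    ultimately show "\<exists>B\<in>\<B>. x \<in> B \<and> B \<subseteq> U" by blast
  qed
  moreover have "|\<B>| \<le>o r"
  proof -
    have "|\<N> \<times> \<N>| \<le>o r"
      using r \<N>(2) by (intro card_of_Times_ordLeq_infinite_Field) (auto simp: cinfinite_def)
    then have "|\<S>| \<le>o r" unfolding \<S>_def by (rule ordLeq_transitive[OF card_of_image])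
    then have "|{\<F>. \<F> \<subseteq> \<S> \<and> finite \<F>}| \<le>o r" using r by (rule card_finite_subsets_ordLeq)
    then show ?thesis unfolding \<B>_def by (rule ordLeq_transitive[OF card_of_image])
  qed
  ultimately show ?thesis by (rule that)
qed

lemma base_of_embedding:
  assumes e: "embedding_map X Y e" and B: "base_of Y \<B>"
  shows "base_of X ((\<lambda>B. {x \<in> topspace X. e x \<in> B}) ` \<B>)"
  unfolding base_of_iff
proof (intro conjI ballI allI impI)
  have cont: "continuous_map X Y e"
    using e by (meson embedding_map_def homeomorphic_imp_continuous_map continuous_map_in_subtopology)
  show "openin X A" if "A \<in> (\<lambda>B. {x \<in> topspace X. e x \<in> B}) ` \<B>" for A
    using that B openin_continuous_map_preimage[OF cont] by (auto simp: base_of_iff)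
  fix U x assume U: "openin X U \<and> x \<in> U"
  then have sub: "U \<subseteq> topspace X" using openin_subset by blast
  have hom: "homeomorphic_map X (subtopology Y (e ` topspace X)) e"
    using e by (simp add: embedding_map_def)
  then have "openin (subtopology Y (e ` topspace X)) (e ` U)"
    using U sub homeomorphic_map_openness by blast
  then obtain V where V: "openin Y V" "e ` U = V \<inter> e ` topspace X"
    by (auto simp: openin_subtopology)
  then have "e x \<in> V" using U by blast
  then obtain B where B': "B \<in> \<B>" "e x \<in> B" "B \<subseteq> V"
    using B V(1) unfolding base_of_iff by metis
  have inj: "inj_on e (topspace X)"
    using hom homeomorphic_imp_injective_map by blast
  have "{y \<in> topspace X. e y \<in> B} \<subseteq> U"
  proof clarify
    fix y assume y: "y \<in> topspace X" "e y \<in> B"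
    then have "e y \<in> e ` U" using B'(3) V(2) by blast
    then show "y \<in> U" using inj_on_image_mem_iff[OF inj y(1) sub] by blast
  qed
  moreover have "x \<in> {y \<in> topspace X. e y \<in> B}" using B'(2) U sub by blast
  ultimately show "\<exists>A\<in>(\<lambda>B. {x \<in> topspace X. e x \<in> B}) ` \<B>. x \<in> A \<and> A \<subseteq> U"
    using B'(1) by blast
qed

section \<open>Subcontinua\<close>

lemma nondegenerate_subcontinuum_iff:
  assumes "continuum K"
  shows "nondegenerate_subcontinuum K C \<longleftrightarrow> closedin K C \<and> connectedin K C \<and> nondegenerate C"
proof -
  have "compactin K C \<longleftrightarrow> closedin K C"
    using assms compactin_imp_closedin closedin_compact_space unfolding continuum_def by blast
  then show ?thesis
    using assms Hausdorff_space_subtopology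
    unfolding nondegenerate_subcontinuum_def continuum_def nondegenerate_def connectedin_def compactin_subspace
    by blast
qed

text \<open>
  Compactness of the complement of \<open>U\<close>, combined with directedness to replace finitely many members
  by a single one.
\<close>

lemma directed_Inter_subset_openD:
  assumes X: "compact_space X" and \<C>: "\<C> \<noteq> {}" "\<And>C. C \<in> \<C> \<Longrightarrow> closedin X C"
    and dir: "\<And>C D. \<lbrakk>C \<in> \<C>; D \<in> \<C>\<rbrakk> \<Longrightarrow> \<exists>E\<in>\<C>. E \<subseteq> C \<inter> D"
    and U: "openin X U" "\<Inter>\<C> \<subseteq> U"
  shows "\<exists>C\<in>\<C>. C \<subseteq> U"
proof -
  have fin: "\<exists>E\<in>\<C>. E \<subseteq> \<Inter>\<F>" if "finite \<F>" "\<F> \<subseteq> \<C>" for \<F>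
    using that
  proof (induction rule: finite_induct)
    case empty
    then show ?case using \<C>(1) by auto
  next
    case (insert C \<F>)
    then obtain E where "E \<in> \<C>" "E \<subseteq> \<Inter>\<F>" by auto
    moreover obtain E' where "E' \<in> \<C>" "E' \<subseteq> C \<inter> E"
      using dir[of C E] insert.prems \<open>E \<in> \<C>\<close> by auto
    ultimately show ?case by auto
  qed
  have "compactin X (topspace X - U)"
    using U X closedin_compact_space by blast
  then have fip: "(topspace X - U) \<inter> \<Inter>\<C> \<noteq> {}"
    if "\<forall>\<F>. finite \<F> \<and> \<F> \<subseteq> \<C> \<longrightarrow> (topspace X - U) \<inter> \<Inter>\<F> \<noteq> {}"
    using that \<C>(2) unfolding compactin_fip by simp
  have "(topspace X - U) \<inter> \<Inter>\<C> = {}"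
    using U(2) unfolding disjoint_iff by (meson DiffD2 subsetD)
  with fip obtain \<F> where \<F>: "finite \<F>" "\<F> \<subseteq> \<C>" "(topspace X - U) \<inter> \<Inter>\<F> = {}"
    by metis
  obtain E where E: "E \<in> \<C>" "E \<subseteq> \<Inter>\<F>" using fin[OF \<F>(1,2)] by metis
  have "E \<subseteq> topspace X" using \<C>(2)[OF E(1)] by (rule closedin_subset)
  then have "E \<subseteq> U" using E(2) \<F>(3) unfolding disjoint_iff by (meson DiffI subsetD subsetI)
  then show ?thesis using E(1) by blast
qed

text \<open>
  A separation of the intersection extends to disjoint open sets by normality. Their union contains
  some member of \<open>\<C>\<close>, which would be disconnected as well.
\<close>

lemma connectedin_directed_Inter:
  assumes X: "compact_space X" "Hausdorff_space X"
    and \<C>: "\<C> \<noteq> {}" "\<And>C. C \<in> \<C> \<Longrightarrow> closedin X C" "\<And>C. C \<in> \<C> \<Longrightarrow> connectedin X C"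
    and dir: "\<And>C D. \<lbrakk>C \<in> \<C>; D \<in> \<C>\<rbrakk> \<Longrightarrow> \<exists>E\<in>\<C>. E \<subseteq> C \<inter> D"
  shows "connectedin X (\<Inter>\<C>)"
proof -
  have clo: "closedin X (\<Inter>\<C>)" using \<C> closedin_Inter by blast
  have "S = {} \<or> T = {}"
    if ST: "closedin X S" "closedin X T" "S \<inter> T = {}" "S \<union> T = \<Inter>\<C>" for S T
  proof -
    have "normal_space X"
      using X compact_Hausdorff_or_regular_imp_normal_space by blast
    then obtain U V where UV: "openin X U" "openin X V" "S \<subseteq> U" "T \<subseteq> V" "disjnt U V"
      using ST unfolding normal_space_def disjnt_def by metis
    have "\<Inter>\<C> \<subseteq> U \<union> V" using UV ST by blast
    then obtain C where C: "C \<in> \<C>" "C \<subseteq> U \<union> V"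
      using directed_Inter_subset_openD[OF X(1) \<C>(1,2) dir, of "U \<union> V"] UV by blast
    then have "U \<inter> C = {} \<or> V \<inter> C = {}"
      using \<C>(3)[OF C(1)] UV unfolding connectedin disjnt_def by blast
    moreover have "S \<subseteq> C" "T \<subseteq> C" using C(1) ST(4) by blast+
    ultimately show ?thesis using UV by blast
  qed
  then show ?thesis
    using closedin_subset[OF clo]
    unfolding connectedin_def connected_space_closedin_eq closedin_closed_subtopology[OF clo]
      topspace_subtopology
    by (metis inf.absorb2)
qed

lemma closedin_component_of_closedin:
  assumes "closedin X B" "C \<in> connected_components_of (subtopology X B)"
  shows "closedin X C" "connectedin X C" "C \<subseteq> B"
proof -
  show "closedin X C"
    using closedin_connected_components_of[OF assms(2)] assms(1) closedin_trans_full by blast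
  show "connectedin X C" "C \<subseteq> B"
    using connectedin_connected_components_of[OF assms(2)] by (auto simp: connectedin_subtopology)
qed

text \<open>
  By boundary bumping, a component of a proper closed subset \<open>B\<close> reaches the frontier of \<open>B\<close>, so it is
  more than a single interior point.
\<close>

lemma nondegenerate_component_at_interior_point:
  assumes K: "continuum K" "nondegenerate (topspace K)" and B: "closedin K B"
    and C: "C \<in> connected_components_of (subtopology K B)"
    and x: "x \<in> C" "openin K V" "x \<in> V" "V \<subseteq> B"
  shows "nondegenerate C"
proof (cases "B = topspace K")
  case True
  then have "C = topspace K"
    using C K(1) connected_components_of_connected_space[of K] by (auto simp: continuum_def split: if_splits)
  then show ?thesis using K by simp
next
  case False
  then have "C \<inter> K frontier_of B \<noteq> {}"
    using boundary_bumping_theorem_closed[OF _ _ _ B False C] K(1) by (simp add: continuum_def)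
  moreover have "x \<notin> K frontier_of B"
    using x interior_of_maximal[of V B K] by (auto simp: frontier_of_def)
  ultimately show ?thesis using x(1) unfolding nondegenerate_def by (metis IntE ex_in_conv)
qed

abbreviation component_in :: "'a topology \<Rightarrow> 'a set \<Rightarrow> 'a \<Rightarrow> 'a set" where
  "component_in X B x \<equiv> connected_component_of_set (subtopology X B) x"

lemma component_in:
  assumes "closedin X B" "x \<in> B"
  shows "component_in X B x \<in> connected_components_of (subtopology X B)"
    and "x \<in> component_in X B x" and "closedin X (component_in X B x)"
    and "connectedin X (component_in X B x)" and "component_in X B x \<subseteq> B"
proof -
  have x: "x \<in> topspace (subtopology X B)"
    using assms closedin_subset by fastforce
  then show *: "component_in X B x \<in> connected_components_of (subtopology X B)"
    by (simp add: connected_component_in_connected_components_of)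
  show "x \<in> component_in X B x" using x by (simp add: connected_component_of_refl)
  show "closedin X (component_in X B x)" "connectedin X (component_in X B x)" "component_in X B x \<subseteq> B"
    using closedin_component_of_closedin[OF assms(1) *] .
qed

lemma component_in_maximal:
  assumes "connectedin X S" "S \<subseteq> B" "x \<in> S"
  shows "S \<subseteq> component_in X B x"
proof (rule connected_component_of_maximal)
  show "connectedin (subtopology X B) S" using assms by (simp add: connectedin_subtopology)
qed (rule assms(3))

text \<open>
  Take the component at \<open>x \<in> F - A\<close> of a closed neighbourhood of \<open>x\<close> in \<open>F\<close> that misses \<open>A\<close>. It is
  non-degenerate by the preceding bumping argument, applied to the continuum \<open>F\<close>.
\<close>

lemma ex_subcontinuum_avoiding:
  assumes K: "continuum K" and F: "nondegenerate_subcontinuum K F"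
    and A: "closedin K A" "\<not> F \<subseteq> A"
  shows "\<exists>D. nondegenerate_subcontinuum K D \<and> D \<subseteq> F - A"
proof -
  let ?L = "subtopology K F"
  have F': "F \<subseteq> topspace K" "continuum ?L" "nondegenerate F" "closedin K F"
    using F nondegenerate_subcontinuum_iff[OF K, of F]
    by (simp_all add: nondegenerate_subcontinuum_def)
  then have top: "topspace ?L = F" by auto
  obtain x where x: "x \<in> F" "x \<notin> A" using A(2) by blast
  have "openin ?L (F - A)"
    unfolding openin_subtopology
    using F'(1) A(1) by (intro exI[of _ "topspace K - A"] conjI openin_diff) auto
  moreover have "regular_space ?L"
    using F'(2) by (simp add: continuum_def compact_Hausdorff_imp_regular_space)
  ultimately obtain V B where B: "openin ?L V" "closedin ?L B" "x \<in> V" "V \<subseteq> B" "B \<subseteq> F - A"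
    using x unfolding neighbourhood_base_of_closedin[symmetric] neighbourhood_base_of
    by (meson DiffI)
  let ?D = "component_in ?L B x"
  have xB: "x \<in> B" using B by blast
  note D = component_in[OF B(2) xB]
  have "nondegenerate ?D"
    using nondegenerate_component_at_interior_point[OF F'(2) _ B(2) D(1,2) B(1,3,4)] F'(3) top by simp
  moreover have "closedin K ?D"
    using D(3) F'(4) closedin_trans_full by blast
  moreover have "connectedin K ?D"
    using D(4) by (simp add: connectedin_subtopology)
  ultimately have "nondegenerate_subcontinuum K ?D"
    by (simp add: nondegenerate_subcontinuum_iff[OF K])
  then show ?thesis using D(5) B(5) by blast
qed

lemma ex_continuous_map_nonconstant:
  assumes K: "continuum K" and F: "nondegenerate_subcontinuum K F"
  shows "\<exists>f. continuous_map K euclideanreal f \<and> (\<exists>x\<in>F. \<exists>y\<in>F. f x \<noteq> f y)"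
proof -
  obtain x y where xy: "x \<in> F" "y \<in> F" "x \<noteq> y" "F \<subseteq> topspace K"
    using F by (auto simp: nondegenerate_subcontinuum_def)
  have "normal_space K"
    using K compact_Hausdorff_or_regular_imp_normal_space by (auto simp: continuum_def)
  moreover have "closedin K {x}" "closedin K {y}"
    using K xy by (auto simp: continuum_def closedin_Hausdorff_sing_eq)
  ultimately obtain f where f: "continuous_map K euclideanreal f" "f ` {x} \<subseteq> {0::real}" "f ` {y} \<subseteq> {1}"
    using Urysohn_lemma_alt[of K "{x}" "{y}" 0 1] xy by auto
  then have "f x \<noteq> f y" by simp
  then show ?thesis using f(1) xy by blast
qed

section \<open>Light families of functions\<close>

text \<open>
  The continuous functions in \<open>H\<close> map \<open>X\<close> to a finite power of the reals if \<open>H\<close> is finite. Closed and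
  open slabs are the preimages of closed and open boxes there.
\<close>

definition slab :: "'a topology \<Rightarrow> (('a \<Rightarrow> real) \<times> real \<times> real) set \<Rightarrow> 'a set" where
  "slab X H = {x \<in> topspace X. \<forall>(f, p, q)\<in>H. p \<le> f x \<and> f x \<le> q}"

definition open_slab :: "'a topology \<Rightarrow> (('a \<Rightarrow> real) \<times> real \<times> real) set \<Rightarrow> 'a set" where
  "open_slab X H = {x \<in> topspace X. \<forall>(f, p, q)\<in>H. p < f x \<and> f x < q}"

lemma open_slab_subset: "open_slab X H \<subseteq> slab X H"
  by (force simp: open_slab_def slab_def)

lemma closedin_slab:
  assumes "\<And>f p q. (f, p, q) \<in> H \<Longrightarrow> continuous_map X euclideanreal f"
  shows "closedin X (slab X H)"
proof -
  let ?S = "\<lambda>(f, p, q). {x \<in> topspace X. f x \<in> {p..q}}"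
  have "slab X H = \<Inter>(insert (topspace X) (?S ` H))"
    by (fastforce simp: slab_def)
  moreover have "closedin X (\<Inter>(insert (topspace X) (?S ` H)))"
  proof (rule closedin_Inter)
    fix S assume "S \<in> insert (topspace X) (?S ` H)"
    then show "closedin X S"
    proof
      assume "S \<in> ?S ` H"
      then obtain f p q where S: "(f, p, q) \<in> H" "S = {x \<in> topspace X. f x \<in> {p..q}}" by auto
      show ?thesis
        unfolding S(2) using assms[OF S(1)] by (rule closedin_continuous_map_preimage) simp
    qed simp
  qed simp
  ultimately show ?thesis by simp
qed

lemma openin_open_slab:
  assumes "finite H" "\<And>f p q. (f, p, q) \<in> H \<Longrightarrow> continuous_map X euclideanreal f"
  shows "openin X (open_slab X H)"
proof -
  let ?S = "\<lambda>(f, p, q). {x \<in> topspace X. f x \<in> {p<..<q}}"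
  have "open_slab X H = \<Inter>(insert (topspace X) (?S ` H))"
    by (fastforce simp: open_slab_def)
  moreover have "openin X (\<Inter>(insert (topspace X) (?S ` H)))"
  proof (rule openin_Inter)
    fix S assume "S \<in> insert (topspace X) (?S ` H)"
    then show "openin X S"
    proof
      assume "S \<in> ?S ` H"
      then obtain f p q where S: "(f, p, q) \<in> H" "S = {x \<in> topspace X. f x \<in> {p<..<q}}" by auto
      show ?thesis
        unfolding S(2) using assms(2)[OF S(1)] by (rule openin_continuous_map_preimage) simp
    qed simp
  qed (use assms in auto)
  ultimately show ?thesis by simp
qed

definition slab_bounds :: "('a \<Rightarrow> real) set \<Rightarrow> (('a \<Rightarrow> real) \<times> real \<times> real) set set" where
  "slab_bounds \<F> = {H. H \<subseteq> \<F> \<times> \<rat> \<times> \<rat> \<and> finite H}"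

definition slab_network :: "'a topology \<Rightarrow> ('a \<Rightarrow> real) set \<Rightarrow> 'a set set" where
  "slab_network K \<F> = (\<Union>H\<in>slab_bounds \<F>.
     {C \<in> connected_components_of (subtopology K (slab K H)). nondegenerate C})"

text \<open>
  Let \<open>x \<in> U\<close> with \<open>U\<close> open. The components at \<open>x\<close> of all slabs having \<open>x\<close> in the open slab form a directed
  family of subcontinua. All functions of the light family are constant on its intersection, which
  therefore is \<open>{x}\<close>, and by compactness one of the components is contained in \<open>U\<close>. It is
  non-degenerate because \<open>x\<close> is an interior point of the slab.
\<close>

lemma network_of_slab_network:
  assumes K: "continuum K" "nondegenerate (topspace K)"
    and cont: "\<And>f. f \<in> \<F> \<Longrightarrow> continuous_map K euclideanreal f"
    and light: "\<And>C. nondegenerate_subcontinuum K C \<Longrightarrow> \<exists>f\<in>\<F>. \<exists>x\<in>C. \<exists>y\<in>C. f x \<noteq> f y"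
  shows "network_of K (slab_network K \<F>)"
  unfolding network_of_def
proof (intro allI impI)
  fix U x assume U: "openin K U \<and> x \<in> U"
  then have x: "x \<in> topspace K" using openin_subset by blast
  define \<H> where "\<H> = {H \<in> slab_bounds \<F>. x \<in> open_slab K H}"
  define C where "C H = component_in K (slab K H) x" for H
  have clo: "closedin K (slab K H)" if "H \<in> \<H>" for H
    using that cont by (intro closedin_slab) (auto simp: \<H>_def slab_bounds_def)
  have xs: "x \<in> slab K H" if "H \<in> \<H>" for H
    using that open_slab_subset[of K H] by (auto simp: \<H>_def)
  note C = component_in[OF clo xs, folded C_def]
  have "{} \<in> \<H>" using x by (simp add: \<H>_def slab_bounds_def open_slab_def)
  then have ne: "C ` \<H> \<noteq> {}" by blast
  have dir: "\<exists>E\<in>C ` \<H>. E \<subseteq> C1 \<inter> C2" if "C1 \<in> C ` \<H>" "C2 \<in> C ` \<H>" for C1 C2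
  proof -
    obtain H1 H2 where H: "H1 \<in> \<H>" "H2 \<in> \<H>" "C1 = C H1" "C2 = C H2" using \<open>C1 \<in> C ` \<H>\<close> \<open>C2 \<in> C ` \<H>\<close> by blast
    have H12: "H1 \<union> H2 \<in> \<H>" using H(1,2) by (auto simp: \<H>_def slab_bounds_def open_slab_def)
    have "slab K (H1 \<union> H2) \<subseteq> slab K H1" "slab K (H1 \<union> H2) \<subseteq> slab K H2"
      unfolding slab_def by blast+
    then have "C (H1 \<union> H2) \<subseteq> slab K H1" "C (H1 \<union> H2) \<subseteq> slab K H2"
      using C(5)[OF H12 H12] by (meson subset_trans)+
    then have "C (H1 \<union> H2) \<subseteq> C H1" "C (H1 \<union> H2) \<subseteq> C H2"
      unfolding C_def[of H1] C_def[of H2]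
      using component_in_maximal[OF C(4)[OF H12 H12] _ C(2)[OF H12 H12]] by metis+
    then show ?thesis using H12 H(3,4) by blast
  qed
  have cloC: "closedin K E" and conC: "connectedin K E" and xC: "x \<in> E" if "E \<in> C ` \<H>" for E
    using C(2,3,4) that by auto
  have "connectedin K (\<Inter>(C ` \<H>))"
    using K(1) connectedin_directed_Inter[OF _ _ ne cloC conC dir] by (simp add: continuum_def)
  moreover have "closedin K (\<Inter>(C ` \<H>))"
    using ne cloC by (intro closedin_Inter)
  moreover have "f y = f x" if f: "f \<in> \<F>" and y: "y \<in> \<Inter>(C ` \<H>)" for f y
  proof (rule ccontr)
    assume "f y \<noteq> f x"
    \<comment> \<open>A slab around \<open>x\<close> given by the single function \<open>f\<close> that excludes \<open>y\<close>.\<close>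
    then obtain p q where pq: "p \<in> \<rat>" "q \<in> \<rat>" "p < f x" "f x < q" "f y < p \<or> q < f y"
    proof (cases "f y < f x")
      case True
      obtain p where "p \<in> \<rat>" "f y < p" "p < f x" using Rats_dense_in_real[OF True] by blast
      moreover obtain q where "q \<in> \<rat>" "f x < q" using Rats_dense_in_real[of "f x" "f x + 1"] by auto
      ultimately show ?thesis using that by blast
    next
      case False
      then have "f x < f y" using \<open>f y \<noteq> f x\<close> by simp
      then obtain q where "q \<in> \<rat>" "f x < q" "q < f y" using Rats_dense_in_real by blast
      moreover obtain p where "p \<in> \<rat>" "p < f x" using Rats_dense_in_real[of "f x - 1" "f x"] by auto
      ultimately show ?thesis using that by blast
    qed
    then have H: "{(f, p, q)} \<in> \<H>"
      using f x by (simp add: \<H>_def slab_bounds_def open_slab_def)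
    then have "y \<in> slab K {(f, p, q)}" using C(5)[OF H H] y by blast
    then show False using pq(5) by (simp add: slab_def)
  qed
  ultimately have "\<not> nondegenerate (\<Inter>(C ` \<H>))"
    using light[of "\<Inter>(C ` \<H>)"] unfolding nondegenerate_subcontinuum_iff[OF K(1)] by metis
  then have "\<Inter>(C ` \<H>) \<subseteq> U"
    using U xC unfolding nondegenerate_def by (metis INT_I image_eqI subsetI)
  then obtain H where H: "H \<in> \<H>" "C H \<subseteq> U"
    using directed_Inter_subset_openD[OF _ ne cloC dir, of U] U K(1) by (auto simp: continuum_def)
  have "finite H" "x \<in> open_slab K H" "H \<in> slab_bounds \<F>" and Hcont: "\<And>f p q. (f, p, q) \<in> H \<Longrightarrow> continuous_map K euclideanreal f"
    using H(1) cont by (auto simp: \<H>_def slab_bounds_def)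
  then have "openin K (open_slab K H)" by (intro openin_open_slab)
  then have "nondegenerate (C H)"
    using \<open>x \<in> open_slab K H\<close> open_slab_subset
    by (rule nondegenerate_component_at_interior_point[OF K clo[OF H(1)] C(1,2)[OF H(1) H(1)]])
  then have "C H \<in> slab_network K \<F>"
    using C(1)[OF H(1) H(1)] \<open>H \<in> slab_bounds \<F>\<close> by (auto simp: slab_network_def)
  then show "\<exists>N\<in>slab_network K \<F>. x \<in> N \<and> N \<subseteq> U"
    using H(2) C(2)[OF H(1) H(1)] by blast
qed

text \<open>
  There are at most \<open>r\<close> slabs, and the non-degenerate components of one slab are disjoint subcontinua.
\<close>

lemma card_slab_network_ordLeq:
  assumes K: "continuum K" and r: "Cinfinite r" and \<F>: "|\<F>| \<le>o r"
    and cont: "\<And>f. f \<in> \<F> \<Longrightarrow> continuous_map K euclideanreal f"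
    and disj: "\<And>\<D>. \<lbrakk>disjoint \<D>; \<And>D. D \<in> \<D> \<Longrightarrow> nondegenerate_subcontinuum K D\<rbrakk> \<Longrightarrow> |\<D>| \<le>o r"
  shows "|slab_network K \<F>| \<le>o r"
  unfolding slab_network_def
proof (intro UNION_Cinfinite_bound ballI r)
  have "countable (\<rat> \<times> \<rat> :: (real \<times> real) set)" by (simp add: countable_rat)
  then have "|\<rat> \<times> \<rat> :: (real \<times> real) set| \<le>o r" using r by (rule countable_ordLeq_Cinfinite)
  then have "|\<F> \<times> (\<rat> \<times> \<rat> :: (real \<times> real) set)| \<le>o r"
    using r by (intro card_of_Times_ordLeq_infinite_Field[OF _ \<F>]) (auto simp: cinfinite_def)
  then show "|slab_bounds \<F>| \<le>o r"
    unfolding slab_bounds_def using r by (rule card_finite_subsets_ordLeq)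
  fix H assume H: "H \<in> slab_bounds \<F>"
  have clo: "closedin K (slab K H)"
    using H cont by (intro closedin_slab) (auto simp: slab_bounds_def)
  let ?\<D> = "{C \<in> connected_components_of (subtopology K (slab K H)). nondegenerate C}"
  show "|?\<D>| \<le>o r"
  proof (rule disj)
    show "disjoint ?\<D>"
      using connected_components_of_disjoint by (fastforce simp: disjoint_def disjnt_def)
    show "nondegenerate_subcontinuum K D" if "D \<in> ?\<D>" for D
      using that closedin_component_of_closedin[OF clo, of D] by (simp add: nondegenerate_subcontinuum_iff[OF K])
  qed
qed

section \<open>The weight of a continuum\<close>

text \<open>
  The splitting process on a continuum: \<open>g F\<close> is the function whose level sets cut \<open>F\<close>.
\<close>

locale split_continuum =
  fixes K :: "'a topology" and g :: "'a set \<Rightarrow> 'a \<Rightarrow> real"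
  assumes K: "continuum K" "nondegenerate (topspace K)"
    and g: "nondegenerate_subcontinuum K F \<Longrightarrow> continuous_map K euclideanreal (g F)"
           "nondegenerate_subcontinuum K F \<Longrightarrow> \<exists>x\<in>F. \<exists>y\<in>F. g F x \<noteq> g F y"
begin

definition level :: "'a set \<Rightarrow> real \<Rightarrow> 'a set" where
  "level F t = {x \<in> F. g F x = t}"

definition level_pieces :: "'a set \<Rightarrow> 'a set set" where
  "level_pieces F = {C. nondegenerate C \<and> (\<exists>t. C \<in> connected_components_of (subtopology K (level F t)))}"

lemmas subcontinuum_iff = nondegenerate_subcontinuum_iff[OF K(1)]

lemma closedin_level:
  assumes "nondegenerate_subcontinuum K F"
  shows "closedin K (level F t)"
  using closedin_continuous_map_preimage_gen[OF g(1)[OF assms], of F "{t}"] assms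
  by (simp add: level_def subcontinuum_iff)

lemma level_piece:
  assumes "nondegenerate_subcontinuum K F" "C \<in> connected_components_of (subtopology K (level F t))"
  shows "closedin K C" "connectedin K C" "C \<subseteq> level F t"
  using closedin_component_of_closedin[OF closedin_level[OF assms(1)] assms(2)] .

sublocale splitting "nondegenerate_subcontinuum K" level_pieces "topspace K"
proof
  show "nondegenerate_subcontinuum K (topspace K)"
    using K by (simp add: subcontinuum_iff continuum_def connectedin_topspace)
  show "nondegenerate F" if "nondegenerate_subcontinuum K F" for F
    using that by (simp add: subcontinuum_iff)
  show "nondegenerate_subcontinuum K (\<Inter>\<C>)"
    if \<C>: "\<C> \<noteq> {}" "\<And>F. F \<in> \<C> \<Longrightarrow> nondegenerate_subcontinuum K F" "chain_subset \<C>" "nondegenerate (\<Inter>\<C>)" for \<C>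
  proof -
    have C: "closedin K C" "connectedin K C" if "C \<in> \<C>" for C
      using \<C>(2)[OF that] by (simp_all add: subcontinuum_iff)
    have dir: "\<exists>E\<in>\<C>. E \<subseteq> C \<inter> D" if "C \<in> \<C>" "D \<in> \<C>" for C D
    proof -
      have "C \<subseteq> D \<or> D \<subseteq> C" using \<C>(3) that by (simp add: chain_subset_def)
      then show ?thesis using that by (metis Int_absorb1 Int_absorb2 subset_refl)
    qed
    have "connectedin K (\<Inter>\<C>)"
      using K(1) connectedin_directed_Inter[OF _ _ \<C>(1) C dir] by (simp add: continuum_def)
    moreover have "closedin K (\<Inter>\<C>)" using \<C>(1) C(1) by (rule closedin_Inter)
    ultimately show ?thesis using \<C>(4) by (simp add: subcontinuum_iff)
  qed
  fix F assume F: "nondegenerate_subcontinuum K F"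
  show "nondegenerate_subcontinuum K C" and "C \<subseteq> F" if "C \<in> level_pieces F" for C
    using that level_piece[OF F, of C] by (auto simp: level_pieces_def subcontinuum_iff level_def)
  show "disjoint (level_pieces F)"
  proof (rule disjointI)
    fix C C' assume C: "C \<in> level_pieces F" "C' \<in> level_pieces F" "C \<noteq> C'"
    then obtain t t' where t: "C \<in> connected_components_of (subtopology K (level F t))"
      "C' \<in> connected_components_of (subtopology K (level F t'))"
      by (auto simp: level_pieces_def)
    show "C \<inter> C' = {}"
    proof (cases "t = t'")
      case True
      then show ?thesis using t C(3) connected_components_of_disjoint[of C _ C'] by (simp add: disjnt_def)
    next
      case False
      then have "level F t \<inter> level F t' = {}" by (auto simp: level_def)
      then show ?thesis using level_piece(3)[OF F t(1)] level_piece(3)[OF F t(2)] by blast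
    qed
  qed
  show "\<exists>D. nondegenerate_subcontinuum K D \<and> D \<subseteq> F - C" if C: "C \<in> level_pieces F" for C
  proof -
    obtain t where t: "C \<in> connected_components_of (subtopology K (level F t))"
      using C by (auto simp: level_pieces_def)
    have "\<not> F \<subseteq> C"
      using g(2)[OF F] level_piece(3)[OF F t] by (auto simp: level_def subset_iff)
    then show ?thesis
      using ex_subcontinuum_avoiding[OF K(1) F] level_piece(1)[OF F t] by blast
  qed
qed

text \<open>
  A subcontinuum \<open>C\<close> cannot be followed forever: in the smallest node \<open>M\<close> above \<open>C\<close> the splitting by
  \<open>g M\<close> has to separate points of \<open>C\<close>, since otherwise a piece of \<open>M\<close> would contain \<open>C\<close>.
\<close>

lemma node_functions_light:
  assumes "nondegenerate_subcontinuum K C"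
  shows "\<exists>f\<in>g ` nodes. \<exists>x\<in>C. \<exists>y\<in>C. f x \<noteq> f y"
proof (rule ccontr)
  assume const: "\<not> ?thesis"
  have C: "nondegenerate C" "connectedin K C" "C \<subseteq> topspace K"
    using assms by (auto simp: subcontinuum_iff closedin_subset)
  then obtain M where M: "M \<in> nodes" "C \<subseteq> M" "\<And>C'. C' \<in> level_pieces M \<Longrightarrow> \<not> C \<subseteq> C'"
    using smallest_node_above[OF C(1,3)] by metis
  obtain x where x: "x \<in> C" using nondegenerate_nonempty[OF C(1)] by blast
  have sub: "C \<subseteq> level M (g M x)"
    using const M(1,2) x unfolding level_def by blast
  let ?C = "component_in K (level M (g M x)) x"
  have CC: "C \<subseteq> ?C" using C(2) sub x by (rule component_in_maximal)
  then have "nondegenerate ?C" using nondegenerate_mono[OF C(1)] by blast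
  moreover have "?C \<in> connected_components_of (subtopology K (level M (g M x)))"
    using sub x by (intro component_in(1) closedin_level node_P M(1)) blast
  ultimately have "?C \<in> level_pieces M" by (auto simp: level_pieces_def)
  then show False using M(3) CC by blast
qed

text \<open>
  Here \<open>r\<close> may be the Suslinian number itself or its successor, according to the number of nodes.
\<close>

lemma ex_base_if_few_nodes:
  assumes r: "Cinfinite r" and nodes: "|nodes| \<le>o r"
    and disj: "\<And>\<D>. \<lbrakk>disjoint \<D>; \<And>D. D \<in> \<D> \<Longrightarrow> nondegenerate_subcontinuum K D\<rbrakk> \<Longrightarrow> |\<D>| \<le>o r"
  shows "\<exists>\<B>. base_of K \<B> \<and> |\<B>| \<le>o r"
proof -
  have cont: "continuous_map K euclideanreal f" if "f \<in> g ` nodes" for f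
    using that g(1) node_P by blast
  have "|g ` nodes| \<le>o r" by (rule ordLeq_transitive[OF card_of_image nodes])
  then have "|slab_network K (g ` nodes)| \<le>o r"
    using card_slab_network_ordLeq[OF K(1) r _ cont disj] by blast
  moreover have "network_of K (slab_network K (g ` nodes))"
    using K cont node_functions_light by (rule network_of_slab_network)
  ultimately show ?thesis
    using K(1) Cinfinite_base_of_if_network_of[OF _ _ _ _ r] by (metis continuum_def)
qed

end

lemma ex_small_base_of_continuum:
  assumes K: "continuum K" and r: "Cinfinite r"
    and disj: "\<And>\<D>. \<lbrakk>disjoint \<D>; \<And>D. D \<in> \<D> \<Longrightarrow> nondegenerate_subcontinuum K D\<rbrakk> \<Longrightarrow> |\<D>| \<le>o r"
  shows "\<exists>\<B>. base_of K \<B> \<and> |\<B>| \<le>o cardSuc r"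
    and "no_Suslin_tree (cardSuc r) \<Longrightarrow> \<exists>\<B>. base_of K \<B> \<and> |\<B>| \<le>o r"
proof -
  have suc: "|A| \<le>o cardSuc r" if "|A| \<le>o r" for A :: "'c set"
    by (rule ordLeq_transitive[OF that cardSuc_ordLeq]) (use r in simp)
  have "(\<exists>\<B>. base_of K \<B> \<and> |\<B>| \<le>o cardSuc r) \<and>
    (no_Suslin_tree (cardSuc r) \<longrightarrow> (\<exists>\<B>. base_of K \<B> \<and> |\<B>| \<le>o r))"
  proof (cases "nondegenerate (topspace K)")
    case False
    then obtain x where "topspace K \<subseteq> {x}" unfolding nondegenerate_def by blast
    then have "{U. openin K U} \<subseteq> Pow {x}" using openin_subset by blast
    then have "countable {U. openin K U}"
      by (meson countable_finite finite.emptyI finite.insertI finite_Pow_iff finite_subset)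
    then have "|{U. openin K U}| \<le>o r" using r by (rule countable_ordLeq_Cinfinite)
    then show ?thesis using suc base_of_openin by blast
  next
    case True
    obtain g where g: "\<And>F. nondegenerate_subcontinuum K F \<Longrightarrow> continuous_map K euclideanreal (g F)"
      "\<And>F. nondegenerate_subcontinuum K F \<Longrightarrow> \<exists>x\<in>F. \<exists>y\<in>F. g F x \<noteq> g F y"
      using ex_continuous_map_nonconstant[OF K] by metis
    interpret split_continuum K g
      using K True g by (rule split_continuum.intro)
    have nodes: "|nodes| \<le>o cardSuc r"
      using r disj by (rule card_nodes_le(1))
    show ?thesis
    proof (intro conjI impI)
      show "\<exists>\<B>. base_of K \<B> \<and> |\<B>| \<le>o cardSuc r"
        using Cinfinite_cardSuc[OF r] nodes suc[OF disj] by (rule ex_base_if_few_nodes)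
      assume "no_Suslin_tree (cardSuc r)"
      with r disj have "|nodes| \<le>o r" by (rule card_nodes_le(2))
      with r show "\<exists>\<B>. base_of K \<B> \<and> |\<B>| \<le>o r"
        using disj by (rule ex_base_if_few_nodes)
    qed
  qed
  then show "\<exists>\<B>. base_of K \<B> \<and> |\<B>| \<le>o cardSuc r"
    and "no_Suslin_tree (cardSuc r) \<Longrightarrow> \<exists>\<B>. base_of K \<B> \<and> |\<B>| \<le>o r"
    by blast+
qed

theorem theorem3:
  fixes X :: "'a topology"
  assumes "tychonov_space X"
  shows "weight X \<le>o cardSuc (Sln TYPE('k) X) \<and>
         (no_Suslin_tree (cardSuc (Sln TYPE('k) X)) \<longrightarrow> weight X \<le>o Sln TYPE('k) X)"
proof -
  let ?R = "{Sln_continuum K | K :: ('a, 'k) ambient topology. continuum K \<and> (\<exists>e. embedding_map X K e)}"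
  have "Sln TYPE('k) X \<in> ?R"
    unfolding Sln_def
  proof (rule card_Min(1))
    show "?R \<noteq> {}" using ex_continuum_embedding[OF assms] by blast
  qed (use Card_order_Sln_continuum in blast)
  then obtain K :: "('a, 'k) ambient topology" and e
    where K: "Sln TYPE('k) X = Sln_continuum K" "continuum K" "embedding_map X K e"
    by blast
  let ?r = "Sln_continuum K"
  have r: "Cinfinite ?r"
    unfolding Sln_continuum_def by (rule Cinfinite_csum1[OF natLeq_Cinfinite])
  have disj: "|\<D>| \<le>o ?r"
    if "disjoint \<D>" "\<And>D. D \<in> \<D> \<Longrightarrow> nondegenerate_subcontinuum K D" for \<D>
    unfolding Sln_continuum_def
    by (rule ordLeq_transitive[OF card_Sup(2) ordLeq_csum2[OF card_Sup(1)]]) (use that in blast)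
  have weight: "weight X \<le>o s" if "base_of K \<B>" "|\<B>| \<le>o s" for \<B> and s :: "'s rel"
    using base_of_embedding[OF K(3) that(1)] ordLeq_transitive[OF card_of_image that(2)]
    by (rule weight_ordLeq)
  show ?thesis
    unfolding K(1) using ex_small_base_of_continuum[OF K(2) r disj] weight by meson
qed

end
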